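(* Consider the network model described in the context with parameters $\{N,K,\alpha_i,p_i^S,p_i^D,\lambda_i,\theta_i\}$ and any renewal packet generation processes at the sources with PMF $f_i(x)=\mathbb{P}(X_i=x)$. Define $$L_B=\frac{1}{2N}\sum_{i=1}^N\alpha_i\left(\frac{1}{q_i^{L_B}}+2\theta_i+1\right),$$ where the numbers $q_i^{L_B}$ are obtained as follows. Let $v_i=\min\{\lambda_i,p_i^Sp_i^D\}$, $\gamma_i=\alpha_ip_i^Sp_i^D/(2Nv_i^2)$ and, for $\gamma>0$, $q_i(\gamma)=v_i\min\{1,\sqrt{\gamma_i/\gamma}\}$ and $S(\gamma)=\sum_{i=1}^N q_i(\gamma)/(p_i^Sp_i^D)$. If $\sum_{i=1}^N v_i/(p_i^Sp_i^D)\ge K$, then $q_i^{L_B}=q_i(\gamma^* )$ for all $i$, where $\gamma^*>0$ is any solution of $S(\gamma^* )=K$ (the values $q_i(\gamma^* )$ do not depend on the choice of solution); otherwise $q_i^{L_B}=v_i$ for all $i$. Then $L_B$ is a lower bound on the Expected Weighted Sum AoI of every admissible policy: $$L_B\le\mathbb{E}[J^\pi]\qquad\text{for all }\pi\in\Pi.$$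
   Context: Network model. There are $N$ sources, $N$ destinations and a base station (BS). Time is slotted, $t=1,2,\ldots$. Packet generation: $a_i(t)=1$ if source $i$ generates a packet in slot $t$, and $a_i(t)=0$ otherwise. Every source generates a packet in slot $1$. The numbers of slots between consecutive generations at source $i$ (inter-generation periods) are i.i.d. copies of $X_i$, which takes values in $\{1,\ldots,\bar x_i\}$, $\bar x_i<\infty$, with PMF $f_i$; the generation rate is $\lambda_i=1/\mathbb{E}[X_i]$. Generation processes of different sources are independent. Each source stores only its most recently generated packet (and keeps it after transmission, so it may transmit repeated packets). The system time of the packet stored at source $i$ is $z_i(t)=t-\tau_i^S(t)$, where $\tau_i^S(t)$ is the slot in which this packet was generated; thus $z_i(t)=0$ if $a_i(t)=1$ and $z_i(t)=z_i(t-1)+1$ otherwise, with $z_i(1)=0$. Scheduling and channels: at the beginning of each slot $t$ the BS chooses $u_i(t)\in\{0,1\}$ with $\sum_{i=1}^N u_i(t)\le K$, where $K\le N$; $u_i(t)=1$ means source $i$ transmits its stored packet. The channel indicators $c_i^S(t),c_i^D(t)\in\{0,1\}$ are i.i.d. over time, independent across $i$ and of each other and of the generation processes, with $\mathbb{P}(c_i^S(t)=1)=p_i^S\in(0,1]$ and $\mathbb{P}(c_i^D(t)=1)=p_i^D\in(0,1]$; they are not known to the BS before deciding. The BS receives the packet in slot $t$ iff $u_i(t)c_i^S(t)=1$ and immediately forwards it; destination $i$ receives it in slot $t+\theta_i$ iff $u_i(t)c_i^S(t)c_i^D(t)=1$, where $\theta_i\ge 0$ is a fixed integer transmission delay. Age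 of Information: let $\Lambda_i(t)=u_i(t-\theta_i)c_i^S(t-\theta_i)c_i^D(t-\theta_i)$ for $t>\theta_i$ and $\Lambda_i(t)=0$ for $t\le\theta_i$. The AoI of destination $i$ satisfies $h_i(1)=1$ and $$h_i(t+1)=\begin{cases}z_i(t-\theta_i)+\theta_i+1&\text{if }\Lambda_i(t)=1,\\ h_i(t)+1&\text{otherwise.}\end{cases}$$ $\Pi$ is the class of non-anticipative scheduling policies, i.e. policies that do not use future information when making scheduling decisions. For weights $\alpha_i>0$, the Expected Weighted Sum AoI (EWSAoI) of $\pi\in\Pi$ is $$\mathbb{E}[J^\pi]=\lim_{T\to\infty}\frac{1}{TN}\sum_{t=1}^T\sum_{i=1}^N\alpha_i\mathbb{E}[h_i^\pi(t)].$$ *)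

theory Defs
  imports "HOL-Probability.Probability"
begin

section \<open>Parameters\<close>

record network =
  num_src :: nat                     \<comment> \<open>\<open>N\<close>; sources and destinations are indexed by \<open>{1..N}\<close>\<close>
  capacity :: nat                    \<comment> \<open>\<open>K\<close>\<close>
  wt :: "nat \<Rightarrow> real"               \<comment> \<open>\<open>\<alpha>\<^sub>i\<close>\<close>
  pS :: "nat \<Rightarrow> real"
  pD :: "nat \<Rightarrow> real"
  delay :: "nat \<Rightarrow> nat"             \<comment> \<open>\<open>\<theta>\<^sub>i\<close>\<close>
  gen_pmf :: "nat \<Rightarrow> nat pmf"       \<comment> \<open>\<open>f\<^sub>i\<close>, the law of the inter-generation periods\<close>
  max_gap :: "nat \<Rightarrow> nat"           \<comment> \<open>the bound on the inter-generation periods of source \<open>i\<close>\<close>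

definition gen_rate :: "network \<Rightarrow> nat \<Rightarrow> real" where
  "gen_rate P i = 1 / measure_pmf.expectation (gen_pmf P i) real"

section \<open>Sample paths of a single source\<close>

text \<open>
  All sequences are indexed by the slot \<open>t = 1, 2, \<dots>\<close>, except the inter-generation periods
  \<open>x\<close>, where \<open>x k\<close> is the time between generations number \<open>k\<close> and \<open>k + 1\<close>, counted from
  \<open>k = 0\<close> (the generation in slot 1).
\<close>

definition generation :: "(nat \<Rightarrow> nat) \<Rightarrow> nat \<Rightarrow> nat" where
  "generation x t = (if \<exists>n. t = 1 + (\<Sum>k<n. x k) then 1 else 0)"

definition last_gen :: "(nat \<Rightarrow> nat) \<Rightarrow> nat \<Rightarrow> nat" where
  "last_gen x t = Max {s \<in> {1..t}. generation x s = 1}"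

definition system_time :: "(nat \<Rightarrow> nat) \<Rightarrow> nat \<Rightarrow> nat" where
  "system_time x t = t - last_gen x t"

lemma generation_1: "generation x (Suc 0) = 1"
  by (auto simp: generation_def intro!: exI[of _ 0])

lemma system_time_1: "system_time x (Suc 0) = 0"
proof -
  have "{s \<in> {1..Suc 0}. generation x s = 1} = {Suc 0}"
    using generation_1[of x] by auto
  then show ?thesis by (simp add: system_time_def last_gen_def)
qed

lemma system_time_Suc:
  assumes "t \<ge> 1"
  shows "system_time x (Suc t) = (if generation x (Suc t) = 1 then 0 else system_time x t + 1)"
proof (cases "generation x (Suc t) = 1")
  case True
  have "last_gen x (Suc t) = Suc t"
    unfolding last_gen_def using True by (intro Max_eqI) auto
  then show ?thesis using True by (simp add: system_time_def)
next
  case False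
  have eq: "{s \<in> {1..Suc t}. generation x s = 1} = {s \<in> {1..t}. generation x s = 1}"
    using False by (auto simp: le_Suc_eq)
  have "last_gen x t \<in> {s \<in> {1..t}. generation x s = 1}"
    unfolding last_gen_def using assms generation_1[of x] by (intro Max_in) auto
  then have "last_gen x t \<le> t" by simp
  moreover have "last_gen x (Suc t) = last_gen x t"
    unfolding last_gen_def eq ..
  ultimately show ?thesis using False by (simp add: system_time_def Suc_diff_le)
qed

definition delivery :: "nat \<Rightarrow> (nat \<Rightarrow> nat) \<Rightarrow> (nat \<Rightarrow> nat) \<Rightarrow> (nat \<Rightarrow> nat) \<Rightarrow> nat \<Rightarrow> nat" where
  "delivery \<theta> u c\<^sub>S c\<^sub>D t = (if t > \<theta> then u (t - \<theta>) * c\<^sub>S (t - \<theta>) * c\<^sub>D (t - \<theta>) else 0)"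

text \<open>The age is meaningful from slot 1 on; its value at 0 is a dummy.\<close>

fun aoi :: "nat \<Rightarrow> (nat \<Rightarrow> nat) \<Rightarrow> (nat \<Rightarrow> nat) \<Rightarrow> (nat \<Rightarrow> nat) \<Rightarrow> (nat \<Rightarrow> nat) \<Rightarrow> nat \<Rightarrow> nat" where
  "aoi \<theta> x u c\<^sub>S c\<^sub>D 0 = 0"
| "aoi \<theta> x u c\<^sub>S c\<^sub>D (Suc 0) = 1"
| "aoi \<theta> x u c\<^sub>S c\<^sub>D (Suc (Suc t)) =
     (if delivery \<theta> u c\<^sub>S c\<^sub>D (Suc t) = 1 then system_time x (Suc t - \<theta>) + \<theta> + 1
      else aoi \<theta> x u c\<^sub>S c\<^sub>D (Suc t) + 1)"

section \<open>The stochastic model\<close>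

text \<open>
  The random inputs are the inter-generation periods \<open>X i k\<close>, the channel indicators
  \<open>cS i t\<close> and \<open>cD i t\<close>, and a seed \<open>W\<close> with values in an arbitrary measurable space \<open>R\<close>,
  which is available to the scheduler for randomized decisions.  The inputs have different
  value types, so joint independence is stated through the generated event families.
\<close>

datatype input = Period nat nat | ChannelS nat nat | ChannelD nat nat | Seed

definition inputs :: "network \<Rightarrow> input set" where
  "inputs P = {Period i k |i k. i \<in> {1..num_src P}}
     \<union> {ChannelS i t |i t. i \<in> {1..num_src P} \<and> t \<ge> 1}
     \<union> {ChannelD i t |i t. i \<in> {1..num_src P} \<and> t \<ge> 1}
     \<union> {Seed}"

fun input_events ::
  "'a measure \<Rightarrow> (nat \<Rightarrow> nat \<Rightarrow> 'a \<Rightarrow> nat) \<Rightarrow> (nat \<Rightarrow> nat \<Rightarrow> 'a \<Rightarrow> nat) \<Rightarrow> (nat \<Rightarrow> nat \<Rightarrow> 'a \<Rightarrow> nat)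
     \<Rightarrow> 'r measure \<Rightarrow> ('a \<Rightarrow> 'r) \<Rightarrow> input \<Rightarrow> 'a set set" where
  "input_events M X cS cD R W (Period i k) = {X i k -` A \<inter> space M |A. A \<in> UNIV}"
| "input_events M X cS cD R W (ChannelS i t) = {cS i t -` A \<inter> space M |A. A \<in> UNIV}"
| "input_events M X cS cD R W (ChannelD i t) = {cD i t -` A \<inter> space M |A. A \<in> UNIV}"
| "input_events M X cS cD R W Seed = {W -` A \<inter> space M |A. A \<in> sets R}"

locale aoi_network = prob_space M
  for M :: "'a measure" +
  fixes P :: network
    and X :: "nat \<Rightarrow> nat \<Rightarrow> 'a \<Rightarrow> nat"
    and cS cD :: "nat \<Rightarrow> nat \<Rightarrow> 'a \<Rightarrow> nat"
    and R :: "'r measure"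
    and W :: "'a \<Rightarrow> 'r"
  assumes capacity_bounds: "1 \<le> capacity P" "capacity P \<le> num_src P"
    and wt_pos: "i \<in> {1..num_src P} \<Longrightarrow> wt P i > 0"
    and pS_range: "i \<in> {1..num_src P} \<Longrightarrow> pS P i \<in> {0<..1}"
    and pD_range: "i \<in> {1..num_src P} \<Longrightarrow> pD P i \<in> {0<..1}"
    and gen_pmf_support: "i \<in> {1..num_src P} \<Longrightarrow> set_pmf (gen_pmf P i) \<subseteq> {1..max_gap P i}"
    and X_measurable: "i \<in> {1..num_src P} \<Longrightarrow> X i k \<in> measurable M (count_space UNIV)"
    and X_distr: "i \<in> {1..num_src P} \<Longrightarrow>
        distr M (count_space UNIV) (X i k) = measure_pmf (gen_pmf P i)"
    and cS_measurable: "i \<in> {1..num_src P} \<Longrightarrow> t \<ge> 1 \<Longrightarrow> cS i t \<in> measurable M (count_space UNIV)"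
    and cS_values: "i \<in> {1..num_src P} \<Longrightarrow> t \<ge> 1 \<Longrightarrow> \<omega> \<in> space M \<Longrightarrow> cS i t \<omega> \<in> {0, 1}"
    and cS_prob: "i \<in> {1..num_src P} \<Longrightarrow> t \<ge> 1 \<Longrightarrow> prob {\<omega> \<in> space M. cS i t \<omega> = 1} = pS P i"
    and cD_measurable: "i \<in> {1..num_src P} \<Longrightarrow> t \<ge> 1 \<Longrightarrow> cD i t \<in> measurable M (count_space UNIV)"
    and cD_values: "i \<in> {1..num_src P} \<Longrightarrow> t \<ge> 1 \<Longrightarrow> \<omega> \<in> space M \<Longrightarrow> cD i t \<omega> \<in> {0, 1}"
    and cD_prob: "i \<in> {1..num_src P} \<Longrightarrow> t \<ge> 1 \<Longrightarrow> prob {\<omega> \<in> space M. cD i t \<omega> = 1} = pD P i"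
    and W_measurable: "W \<in> measurable M R"
    and inputs_indep: "indep_sets (input_events M X cS cD R W) (inputs P)"

section \<open>Non-anticipative policies\<close>

text \<open>
  The largest information the scheduler can have at the beginning of slot \<open>t\<close> without looking
  into the future: its seed, all generations up to and including slot \<open>t\<close>, and all channel
  states strictly before slot \<open>t\<close>.
\<close>

definition info :: "network \<Rightarrow> 'a measure \<Rightarrow> (nat \<Rightarrow> nat \<Rightarrow> 'a \<Rightarrow> nat) \<Rightarrow> (nat \<Rightarrow> nat \<Rightarrow> 'a \<Rightarrow> nat)
     \<Rightarrow> (nat \<Rightarrow> nat \<Rightarrow> 'a \<Rightarrow> nat) \<Rightarrow> 'r measure \<Rightarrow> ('a \<Rightarrow> 'r) \<Rightarrow> nat \<Rightarrow> 'a measure" where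
  "info P M X cS cD R W t = sigma (space M)
     ({W -` A \<inter> space M |A. A \<in> sets R}
      \<union> {{\<omega> \<in> space M. generation (\<lambda>k. X i k \<omega>) s = 1} |i s. i \<in> {1..num_src P} \<and> 1 \<le> s \<and> s \<le> t}
      \<union> {{\<omega> \<in> space M. cS i s \<omega> = 1} |i s. i \<in> {1..num_src P} \<and> 1 \<le> s \<and> s < t}
      \<union> {{\<omega> \<in> space M. cD i s \<omega> = 1} |i s. i \<in> {1..num_src P} \<and> 1 \<le> s \<and> s < t})"

text \<open>
  A policy is represented by its decision processes \<open>u i t\<close>.  The inputs do not depend on the
  decisions, so past decisions add nothing to the information above.
\<close>

definition policies :: "network \<Rightarrow> 'a measure \<Rightarrow> (nat \<Rightarrow> nat \<Rightarrow> 'a \<Rightarrow> nat) \<Rightarrow> (nat \<Rightarrow> nat \<Rightarrow> 'a \<Rightarrow> nat)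
     \<Rightarrow> (nat \<Rightarrow> nat \<Rightarrow> 'a \<Rightarrow> nat) \<Rightarrow> 'r measure \<Rightarrow> ('a \<Rightarrow> 'r) \<Rightarrow> (nat \<Rightarrow> nat \<Rightarrow> 'a \<Rightarrow> nat) set" where
  "policies P M X cS cD R W = {u. \<forall>t\<ge>1.
     (\<forall>i\<in>{1..num_src P}. u i t \<in> measurable (info P M X cS cD R W t) (count_space UNIV)) \<and>
     (\<forall>\<omega>\<in>space M. (\<forall>i\<in>{1..num_src P}. u i t \<omega> \<in> {0, 1}) \<and>
                   (\<Sum>i=1..num_src P. u i t \<omega>) \<le> capacity P)}"

section \<open>Expected weighted sum age\<close>

definition age :: "network \<Rightarrow> (nat \<Rightarrow> nat \<Rightarrow> 'a \<Rightarrow> nat) \<Rightarrow> (nat \<Rightarrow> nat \<Rightarrow> 'a \<Rightarrow> nat)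
     \<Rightarrow> (nat \<Rightarrow> nat \<Rightarrow> 'a \<Rightarrow> nat) \<Rightarrow> (nat \<Rightarrow> nat \<Rightarrow> 'a \<Rightarrow> nat) \<Rightarrow> nat \<Rightarrow> nat \<Rightarrow> 'a \<Rightarrow> nat" where
  "age P X cS cD u i t \<omega> =
     aoi (delay P i) (\<lambda>k. X i k \<omega>) (\<lambda>s. u i s \<omega>) (\<lambda>s. cS i s \<omega>) (\<lambda>s. cD i s \<omega>) t"

definition avg_age :: "network \<Rightarrow> 'a measure \<Rightarrow> (nat \<Rightarrow> nat \<Rightarrow> 'a \<Rightarrow> nat) \<Rightarrow> (nat \<Rightarrow> nat \<Rightarrow> 'a \<Rightarrow> nat)
     \<Rightarrow> (nat \<Rightarrow> nat \<Rightarrow> 'a \<Rightarrow> nat) \<Rightarrow> (nat \<Rightarrow> nat \<Rightarrow> 'a \<Rightarrow> nat) \<Rightarrow> nat \<Rightarrow> real" where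
  "avg_age P M X cS cD u T = 1 / (real T * real (num_src P)) *
     (\<Sum>t=1..T. \<Sum>i=1..num_src P. wt P i * (\<integral>\<omega>. real (age P X cS cD u i t \<omega>) \<partial>M))"

text \<open>
  The limit of \<open>avg_age\<close> need not exist for every policy, and it may be infinite.  The limit
  inferior in the extended reals is defined for all policies and is the limit whenever that exists.
\<close>

definition ewsaoi :: "network \<Rightarrow> 'a measure \<Rightarrow> (nat \<Rightarrow> nat \<Rightarrow> 'a \<Rightarrow> nat) \<Rightarrow> (nat \<Rightarrow> nat \<Rightarrow> 'a \<Rightarrow> nat)
     \<Rightarrow> (nat \<Rightarrow> nat \<Rightarrow> 'a \<Rightarrow> nat) \<Rightarrow> (nat \<Rightarrow> nat \<Rightarrow> 'a \<Rightarrow> nat) \<Rightarrow> ereal" where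
  "ewsaoi P M X cS cD u = liminf (\<lambda>T. ereal (avg_age P M X cS cD u T))"

lemma ewsaoi_eq_limit:
  assumes "(\<lambda>T. ereal (avg_age P M X cS cD u T)) \<longlonglongrightarrow> J"
  shows "ewsaoi P M X cS cD u = J"
  unfolding ewsaoi_def by (rule lim_imp_Liminf[OF sequentially_bot assms])

section \<open>The lower bound\<close>

definition v_max :: "network \<Rightarrow> nat \<Rightarrow> real" where
  "v_max P i = min (gen_rate P i) (pS P i * pD P i)"

definition gamma_src :: "network \<Rightarrow> nat \<Rightarrow> real" where
  "gamma_src P i = wt P i * pS P i * pD P i / (2 * real (num_src P) * (v_max P i)\<^sup>2)"

definition q_of :: "network \<Rightarrow> real \<Rightarrow> nat \<Rightarrow> real" where
  "q_of P \<gamma> i = v_max P i * min 1 (sqrt (gamma_src P i / \<gamma>))"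

definition S_of :: "network \<Rightarrow> real \<Rightarrow> real" where
  "S_of P \<gamma> = (\<Sum>i=1..num_src P. q_of P \<gamma> i / (pS P i * pD P i))"

definition constrained :: "network \<Rightarrow> bool" where
  "constrained P \<longleftrightarrow> (\<Sum>i=1..num_src P. v_max P i / (pS P i * pD P i)) \<ge> real (capacity P)"

definition is_multiplier :: "network \<Rightarrow> real \<Rightarrow> bool" where
  "is_multiplier P \<gamma> \<longleftrightarrow> \<gamma> > 0 \<and> S_of P \<gamma> = real (capacity P)"

text \<open>In the unconstrained case the argument \<open>\<gamma>\<close> is irrelevant.\<close>

definition q_LB :: "network \<Rightarrow> real \<Rightarrow> nat \<Rightarrow> real" where
  "q_LB P \<gamma> i = (if constrained P then q_of P \<gamma> i else v_max P i)"

definition L_B :: "network \<Rightarrow> real \<Rightarrow> real" where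
  "L_B P \<gamma> = 1 / (2 * real (num_src P)) *
     (\<Sum>i=1..num_src P. wt P i * (1 / q_LB P \<gamma> i + 2 * real (delay P i) + 1))"

end

theory Submission
  imports Defs
begin

text \<open>
  Call a slot a reset if the age fails to grow in it. Between resets the age grows linearly from at
  least \<open>\<theta> + 1\<close>, so with \<open>G\<close> resets up to time \<open>T\<close> and any constant \<open>c\<close>, the inequality
  \<open>I\<^sup>2 \<ge> 2 c I - c\<^sup>2\<close> for the reset intervals \<open>I\<close> gives on every sample path
  \<open>\<Sum>h \<ge> T (\<theta> + 1/2 + c) - c\<^sup>2 G / 2 - O(1)\<close>. This bound is linear in \<open>G\<close>, so it
  passes to expectations without any ergodic argument.
  Every reset needs a new packet, hence \<open>E G \<le> \<lambda> T + O(1)\<close> by Wald's identity, and a successful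
  transmission, hence \<open>E G\<close> is at most \<open>p\<^sup>S p\<^sup>D\<close> times the expected number of attempts, of which the
  capacity allows \<open>K\<close> per slot. Taking \<open>c = 1 / q\<^sub>i\<close> with the optimal rates \<open>q\<^sub>i\<close> of the relaxed
  problem, optimality of these rates turns the bound into \<open>L_B\<close>.
\<close>

section \<open>Resets of the age on a sample path\<close>

lemma sawtooth_sum_bound:
  fixes h :: "nat \<Rightarrow> real" and \<theta> c :: real
  assumes start: "h 1 = 1"
    and grow: "\<And>t. t \<ge> 1 \<Longrightarrow> t \<notin> J \<Longrightarrow> h (Suc t) \<ge> h t + 1"
    and reset: "\<And>t. t \<ge> 1 \<Longrightarrow> t \<in> J \<Longrightarrow> h (Suc t) \<ge> \<theta> + 1"
    and "T \<ge> 1"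
  shows "(\<Sum>t=1..T. h t) \<ge> real T * (\<theta> + 1/2 + c)
           - c\<^sup>2 / 2 * (real (card (J \<inter> {1..<T})) + 1) - c * \<theta> - \<theta>\<^sup>2 / 2"
proof -
  \<comment> \<open>\<open>b\<close> counts the slots since the last reset; before the first reset it starts from \<open>1 - \<theta>\<close>,
    which costs the terms \<open>c * \<theta> + \<theta>\<^sup>2 / 2\<close>.\<close>
  have "\<exists>b. b \<le> h T - \<theta> \<and> (\<Sum>t=1..T. h t - \<theta>) \<ge> real T / 2 + c * (real T - b)
          - c\<^sup>2 / 2 * real (card (J \<inter> {1..<T})) + b\<^sup>2 / 2 - c * \<theta> - \<theta>\<^sup>2 / 2"
    using \<open>T \<ge> 1\<close>
  proof (induction T rule: dec_induct)
    case base
    show ?case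
      by (rule exI[of _ "1 - \<theta>"]) (simp add: start[simplified] power2_eq_square field_simps)
  next
    case (step T)
    then obtain b where b: "b \<le> h T - \<theta>"
      and inv: "(\<Sum>t=1..T. h t - \<theta>) \<ge> real T / 2 + c * (real T - b)
          - c\<^sup>2 / 2 * real (card (J \<inter> {1..<T})) + b\<^sup>2 / 2 - c * \<theta> - \<theta>\<^sup>2 / 2"
      by auto
    have sum: "(\<Sum>t=1..Suc T. h t - \<theta>) = (\<Sum>t=1..T. h t - \<theta>) + (h (Suc T) - \<theta>)"
      by simp
    show ?case
    proof (cases "T \<in> J")
      case True
      have "J \<inter> {1..<Suc T} = insert T (J \<inter> {1..<T})"
        using True step(1) by auto
      then have card: "real (card (J \<inter> {1..<Suc T})) = real (card (J \<inter> {1..<T})) + 1"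
        by simp
      have "h (Suc T) \<ge> \<theta> + 1"
        using reset[of T] True step(1) by simp
      \<comment> \<open>A closed interval of length \<open>b\<close> has contributed
        \<open>b^2/2 - c*b\<close>; by \<open>(b - c)^2 \<ge> 0\<close> this is at least
        \<open>-c^2/2\<close>, the charge for one more reset. The next interval starts with
        \<open>b = 1\<close> because the age is then at least \<open>\<theta> + 1\<close>.\<close>
      moreover have "b * c \<le> b * b / 2 + c * c / 2"
        using sum_squares_bound[of b c] by (simp add: power2_eq_square)
      moreover have "real (Suc T) / 2 + c * (real (Suc T) - 1)
          - c\<^sup>2 / 2 * (real (card (J \<inter> {1..<T})) + 1) + 1\<^sup>2 / 2 - c * \<theta> - \<theta>\<^sup>2 / 2
        = (real T / 2 + c * (real T - b) - c\<^sup>2 / 2 * real (card (J \<inter> {1..<T}))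
          + b\<^sup>2 / 2 - c * \<theta> - \<theta>\<^sup>2 / 2) + 1 + (b * c - b * b / 2 - c * c / 2)"
        by (simp add: power2_eq_square field_simps)
      ultimately show ?thesis
        unfolding sum card using inv by (intro exI[of _ 1] conjI) linarith+
    next
      case False
      then have card: "J \<inter> {1..<Suc T} = J \<inter> {1..<T}"
        by (auto simp: less_Suc_eq)
      have "h (Suc T) \<ge> h T + 1"
        using grow[of T] False step(1) by simp
      then have "b + 1 \<le> h (Suc T) - \<theta>"
        using b by linarith
      moreover have "real (Suc T) / 2 + c * (real (Suc T) - (b + 1)) - c\<^sup>2 / 2 * real (card (J \<inter> {1..<T}))
          + (b + 1)\<^sup>2 / 2 - c * \<theta> - \<theta>\<^sup>2 / 2
        = (real T / 2 + c * (real T - b) - c\<^sup>2 / 2 * real (card (J \<inter> {1..<T}))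
          + b\<^sup>2 / 2 - c * \<theta> - \<theta>\<^sup>2 / 2) + (b + 1)"
        by (simp add: power2_eq_square field_simps)
      ultimately show ?thesis
        unfolding sum card using inv by (intro exI[of _ "b + 1"] conjI) linarith+
    qed
  qed
  then obtain b where "(\<Sum>t=1..T. h t - \<theta>) \<ge> real T / 2 + c * (real T - b)
          - c\<^sup>2 / 2 * real (card (J \<inter> {1..<T})) + b\<^sup>2 / 2 - c * \<theta> - \<theta>\<^sup>2 / 2"
    by blast
  \<comment> \<open>The interval still open at time \<open>T\<close> is charged in the same way,
    hence the \<open>+ 1\<close> next to the number of resets.\<close>
  moreover have "(b - c)\<^sup>2 \<ge> 0"
    by simp
  ultimately show ?thesis
    by (simp add: sum_subtractf power2_eq_square algebra_simps)
qed

section \<open>The age and the freshest delivered packet\<close>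

lemma aoi_Suc:
  assumes "t \<ge> 1"
  shows "aoi \<theta> x u cS cD (Suc t) =
    (if delivery \<theta> u cS cD t = 1 then system_time x (t - \<theta>) + \<theta> + 1 else aoi \<theta> x u cS cD t + 1)"
  using assms by (cases t) simp_all

lemma last_gen_in:
  assumes "t \<ge> 1"
  shows "last_gen x t \<in> {1..t} \<and> generation x (last_gen x t) = 1"
proof -
  have "last_gen x t \<in> {s \<in> {1..t}. generation x s = 1}"
    unfolding last_gen_def using assms generation_1[of x] by (intro Max_in) auto
  then show ?thesis
    by simp
qed

lemma last_gen_mono:
  assumes "1 \<le> s" "s \<le> t"
  shows "last_gen x s \<le> last_gen x t"
  unfolding last_gen_def[of x t] using assms last_gen_in[of s x] by (intro Max_ge) auto

text \<open>Failure to grow, rather than delivery, is the criterion: a repeated packet can be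
  delivered while the age still grows by one, so deliveries need not be bounded by
  generations.\<close>

definition resets :: "(nat \<Rightarrow> nat) \<Rightarrow> nat set" where
  "resets h = {t. t \<ge> 1 \<and> h (Suc t) \<le> h t}"

text \<open>
  The generation slot \<open>t - h t\<close> of the freshest delivered packet never decreases, and a reset moves
  it to a later generation slot.
\<close>

lemma resets_le_generations_aux:
  fixes \<theta> :: nat and x u cS cD
  defines "h \<equiv> aoi \<theta> x u cS cD"
  assumes "T \<ge> 1"
  shows "\<exists>d. h T + d = T \<and> d \<le> (if T > Suc \<theta> then last_gen x (T - 1 - \<theta>) else 0) \<and>
    card (resets h \<inter> {1..<T}) \<le> card {s \<in> {1..d}. generation x s = 1}"
  using \<open>T \<ge> 1\<close>
proof (induction T rule: dec_induct)
  case base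
  \<comment> \<open>The initial age 1 acts like a fictitious packet from slot 0, so
    \<open>d = 0\<close>.\<close>
  show ?case
    by (simp add: h_def)
next
  case (step T)
  then obtain d where d: "h T + d = T" "d \<le> (if T > Suc \<theta> then last_gen x (T - 1 - \<theta>) else 0)"
    and card: "card (resets h \<inter> {1..<T}) \<le> card {s \<in> {1..d}. generation x s = 1}"
    by blast
  \<comment> \<open>A fixed delay preserves the transmission order: a packet sent before slot
    \<open>T - \<theta>\<close> was generated no later than the one stored in that slot.\<close>
  have d_le: "d \<le> last_gen x (T - \<theta>)" if "T > \<theta>"
  proof (cases "T > Suc \<theta>")
    case True
    then have "last_gen x (T - 1 - \<theta>) \<le> last_gen x (T - \<theta>)"
      by (intro last_gen_mono) auto
    then show ?thesis
      using d(2) True by simp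
  qed (use d(2) in simp)
  show ?case
  proof (cases "delivery \<theta> u cS cD T = 1")
    case True
    then have gt: "T > \<theta>"
      by (auto simp: delivery_def split: if_splits)
    define L where "L = last_gen x (T - \<theta>)"
    have L: "1 \<le> L" "L \<le> T - \<theta>" "generation x L = 1"
      using last_gen_in[of "T - \<theta>" x] gt by (auto simp: L_def)
    have hS: "h (Suc T) + L = Suc T"
      using aoi_Suc[of T \<theta> x u cS cD] step(1) True L gt
      by (simp add: h_def system_time_def L_def[symmetric])
    have dL: "d \<le> L"
      using d_le gt by (simp add: L_def)
    have "card (resets h \<inter> {1..<Suc T}) \<le> card {s \<in> {1..L}. generation x s = 1}"
    proof (cases "T \<in> resets h")
      case r: True
      \<comment> \<open>Since \<open>h (Suc T) = Suc T - L\<close> and \<open>h T = T - d\<close>, a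
        reset forces \<open>L > d\<close>, so \<open>L\<close> is a generation slot not counted so
        far.\<close>
      then have "d < L"
        using hS d(1) by (auto simp: resets_def)
      have "resets h \<inter> {1..<Suc T} = insert T (resets h \<inter> {1..<T})"
        using r step(1) by auto
      then have "card (resets h \<inter> {1..<Suc T}) \<le> card (insert L {s \<in> {1..d}. generation x s = 1})"
        using card \<open>d < L\<close> by simp
      also have "\<dots> \<le> card {s \<in> {1..L}. generation x s = 1}"
        using L \<open>d < L\<close> by (intro card_mono) auto
      finally show ?thesis .
    next
      case r: False
      then have "resets h \<inter> {1..<Suc T} = resets h \<inter> {1..<T}"
        by (auto simp: less_Suc_eq)
      also have "card \<dots> \<le> card {s \<in> {1..L}. generation x s = 1}"
        using dL by (intro order_trans[OF card] card_mono) auto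
      finally show ?thesis .
    qed
    then show ?thesis
      using hS gt by (intro exI[of _ L]) (simp add: L_def)
  next
    case False
    then have hS: "h (Suc T) = h T + 1"
      using aoi_Suc[of T \<theta> x u cS cD] step(1) by (simp add: h_def)
    then have "resets h \<inter> {1..<Suc T} = resets h \<inter> {1..<T}"
      by (auto simp: resets_def less_Suc_eq)
    then show ?thesis
      using hS d card d_le by (intro exI[of _ d]) auto
  qed
qed

text \<open>This deterministic bound makes the age integrable for every policy.\<close>

lemma aoi_le: "aoi \<theta> x u cS cD t \<le> t"
  using resets_le_generations_aux[of t \<theta> x u cS cD] by (cases "t = 0") auto

lemma resets_le_generations:
  "card (resets (aoi \<theta> x u cS cD) \<inter> {1..<T}) \<le> card {s \<in> {1..T}. generation x s = 1}"
proof (cases "T \<ge> 1")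
  case True
  then obtain d where "d \<le> T"
    "card (resets (aoi \<theta> x u cS cD) \<inter> {1..<T}) \<le> card {s \<in> {1..d}. generation x s = 1}"
    using resets_le_generations_aux[of T \<theta> x u cS cD] by (metis le_add2)
  moreover have "card {s \<in> {1..d}. generation x s = 1} \<le> card {s \<in> {1..T}. generation x s = 1}"
    using \<open>d \<le> T\<close> by (intro card_mono) auto
  ultimately show ?thesis
    by simp
qed simp

lemma resets_imp_delivery:
  assumes "t \<in> resets (aoi \<theta> x u cS cD)"
  shows "delivery \<theta> u cS cD t = 1"
  using assms aoi_Suc[of t \<theta> x u cS cD] by (auto simp: resets_def split: if_splits)

text \<open>A reset in slot \<open>t\<close> is caused by a success in slot
  \<open>t - \<theta>\<close>, and shifting back by the delay sends distinct resets to distinct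
  successes.\<close>

lemma resets_le_deliveries:
  "card (resets (aoi \<theta> x u cS cD) \<inter> {1..<T}) \<le> card {s \<in> {1..T}. u s * cS s * cD s = 1}"
proof -
  let ?J = "resets (aoi \<theta> x u cS cD) \<inter> {1..<T}"
  have *: "t > \<theta> \<and> u (t - \<theta>) * cS (t - \<theta>) * cD (t - \<theta>) = 1" if "t \<in> ?J" for t
    using resets_imp_delivery[of t \<theta> x u cS cD] that
    by (auto simp: delivery_def split: if_splits)
  \<comment> \<open>Truncated subtraction is injective here because every reset satisfies
    \<open>t > \<theta>\<close>.\<close>
  have "inj_on (\<lambda>t. t - \<theta>) ?J"
  proof (rule inj_onI)
    fix s t assume "s \<in> ?J" "t \<in> ?J" "s - \<theta> = t - \<theta>"
    then show "s = t"
      using *[of s] *[of t] by linarith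
  qed
  then have "card ?J = card ((\<lambda>t. t - \<theta>) ` ?J)"
    by (simp add: card_image)
  also have "\<dots> \<le> card {s \<in> {1..T}. u s * cS s * cD s = 1}"
  proof (intro card_mono image_subsetI)
    fix t assume "t \<in> ?J"
    then show "t - \<theta> \<in> {s \<in> {1..T}. u s * cS s * cD s = 1}"
      using *[of t] by auto
  qed simp
  finally show ?thesis .
qed

lemma aoi_sum_bound:
  fixes \<theta> :: nat and c :: real
  assumes "T \<ge> 1"
  shows "(\<Sum>t=1..T. real (aoi \<theta> x u cS cD t)) \<ge> real T * (real \<theta> + 1/2 + c)
    - c\<^sup>2 / 2 * (real (card (resets (aoi \<theta> x u cS cD) \<inter> {1..<T})) + 1) - c * real \<theta> - (real \<theta>)\<^sup>2 / 2"
proof (rule sawtooth_sum_bound[OF _ _ _ assms])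
  fix t :: nat assume t: "t \<ge> 1"
  \<comment> \<open>Ages are integers, so an increase is an increase by at least one; a reset is a
    delivery, whose packet has age at least \<open>\<theta> + 1\<close> on arrival.\<close>
  show "real (aoi \<theta> x u cS cD (Suc t)) \<ge> real (aoi \<theta> x u cS cD t) + 1"
    if "t \<notin> resets (aoi \<theta> x u cS cD)"
    using t that by (auto simp: resets_def)
  show "real (aoi \<theta> x u cS cD (Suc t)) \<ge> real \<theta> + 1"
    if "t \<in> resets (aoi \<theta> x u cS cD)"
    using aoi_Suc[OF t, of \<theta> x u cS cD] resets_imp_delivery[OF that] by simp
qed simp

section \<open>Generations as renewals\<close>

lemma generations_le_renewals:
  assumes "\<And>k. x k \<ge> 1"
  shows "card {s \<in> {1..T}. generation x s = 1} \<le> card {n \<in> {..<T}. (\<Sum>k<n. x k) < T}"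
proof -
  \<comment> \<open>Each period lasts at least one slot, so only indices below \<open>T\<close> can
    give generations up to slot \<open>T\<close>; the count becomes a finite sum.\<close>
  have ge: "n \<le> (\<Sum>k<n. x k)" for n
    using sum_mono[of "{..<n}" "\<lambda>_. 1" x] assms by simp
  have "{s \<in> {1..T}. generation x s = 1} \<subseteq> (\<lambda>n. 1 + (\<Sum>k<n. x k)) ` {n \<in> {..<T}. (\<Sum>k<n. x k) < T}"
  proof
    fix s assume "s \<in> {s \<in> {1..T}. generation x s = 1}"
    then obtain n where n: "s = 1 + (\<Sum>k<n. x k)" "s \<le> T"
      by (auto simp: generation_def split: if_splits)
    then have "n < T"
      using ge[of n] by simp
    then show "s \<in> (\<lambda>n. 1 + (\<Sum>k<n. x k)) ` {n \<in> {..<T}. (\<Sum>k<n. x k) < T}"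
      using n by auto
  qed
  then show ?thesis
    by (intro surj_card_le) auto
qed

text \<open>The pathwise half of Wald's identity: periods are added only while their sum is below
  \<open>T\<close>, so only the last one added can overshoot.\<close>

lemma renewal_overshoot:
  fixes x :: "nat \<Rightarrow> nat"
  assumes "\<And>k. x k \<le> b"
  shows "(\<Sum>n<m. if (\<Sum>k<n. x k) < T then x n else 0) \<le> T + b"
proof -
  \<comment> \<open>The minimum makes the induction go through: before \<open>T\<close> is reached
    the stopped sum is controlled by the full sum, afterwards it is frozen.\<close>
  have "(\<Sum>n<m. if (\<Sum>k<n. x k) < T then x n else 0) \<le> min (\<Sum>k<m. x k) (T + b)"
  proof (induction m)
    case (Suc m)
    show ?case
      using Suc assms[of m] by (cases "(\<Sum>k<m. x k) < T") auto
  qed simp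
  then show ?thesis
    by simp
qed

section \<open>The relaxed optimization problem\<close>

text \<open>The multiplier is a price of capacity, and a higher price lowers every rate; this drives
  the uniqueness of the optimal rates.\<close>

lemma q_of_antimono:
  assumes "0 < \<gamma>" "\<gamma> \<le> \<gamma>'" "v_max P i \<ge> 0" "gamma_src P i \<ge> 0"
  shows "q_of P \<gamma>' i \<le> q_of P \<gamma> i"
proof -
  have "gamma_src P i / \<gamma>' \<le> gamma_src P i / \<gamma>"
    using assms by (intro divide_left_mono) auto
  then show ?thesis
    unfolding q_of_def using assms by (intro mult_left_mono min.mono) auto
qed

context aoi_network
begin

section \<open>Periods, rates and positivity of the parameters\<close>

abbreviation "src \<equiv> {1..num_src P}"

text \<open>The model fixes only the law of the periods, so their range holds almost surely; by
  countability one null set serves all \<open>k\<close>.\<close>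

lemma AE_X_range:
  assumes "i \<in> src"
  shows "AE \<omega> in M. \<forall>k. 1 \<le> X i k \<omega> \<and> X i k \<omega> \<le> max_gap P i"
proof (subst AE_all_countable, intro allI)
  fix k
  have "AE n in distr M (count_space UNIV) (X i k). 1 \<le> n \<and> n \<le> max_gap P i"
    unfolding X_distr[OF assms] AE_measure_pmf_iff using gen_pmf_support[OF assms] by auto
  then show "AE \<omega> in M. 1 \<le> X i k \<omega> \<and> X i k \<omega> \<le> max_gap P i"
    by (subst (asm) AE_distr_iff) (auto intro: X_measurable assms)
qed

lemma X_integrable:
  assumes "i \<in> src"
  shows "integrable M (\<lambda>\<omega>. real (X i k \<omega>))"
proof (rule integrable_const_bound[where B = "real (max_gap P i)"])
  show "AE \<omega> in M. norm (real (X i k \<omega>)) \<le> real (max_gap P i)"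
    using AE_X_range[OF assms] by eventually_elim auto
  show "(\<lambda>\<omega>. real (X i k \<omega>)) \<in> borel_measurable M"
    using X_measurable[OF assms, of k] by measurable
qed

lemma X_expectation:
  assumes "i \<in> src"
  shows "expectation (\<lambda>\<omega>. real (X i k \<omega>)) = 1 / gen_rate P i"
proof -
  have "expectation (\<lambda>\<omega>. real (X i k \<omega>)) = integral\<^sup>L (distr M (count_space UNIV) (X i k)) real"
    by (subst integral_distr) (auto intro: X_measurable assms)
  then show ?thesis
    by (simp add: X_distr[OF assms] gen_rate_def)
qed

lemma gen_rate_pos:
  assumes "i \<in> src"
  shows "gen_rate P i > 0"
proof -
  have "1 \<le> expectation (\<lambda>\<omega>. real (X i 0 \<omega>))"
  proof (rule integral_ge_const[OF X_integrable[OF assms]])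
    show "AE \<omega> in M. 1 \<le> real (X i 0 \<omega>)"
      using AE_X_range[OF assms] by eventually_elim (simp add: Suc_le_eq)
  qed
  then have "0 < 1 / gen_rate P i"
    unfolding X_expectation[OF assms] by linarith
  then show ?thesis
    by (simp add: zero_less_divide_iff)
qed

lemma p_pos:
  assumes "i \<in> src"
  shows "pS P i * pD P i > 0"
  using pS_range[OF assms] pD_range[OF assms] by simp

lemma v_max_pos: "i \<in> src \<Longrightarrow> v_max P i > 0"
  using gen_rate_pos p_pos by (simp add: v_max_def)

lemma num_src_pos: "num_src P > 0"
  using capacity_bounds by simp

lemma gamma_src_pos:
  assumes "i \<in> src"
  shows "gamma_src P i > 0"
  using v_max_pos[OF assms] p_pos[OF assms] wt_pos[OF assms] num_src_pos
  by (simp add: gamma_src_def mult.assoc)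

lemma q_of_pos: "i \<in> src \<Longrightarrow> \<gamma> > 0 \<Longrightarrow> q_of P \<gamma> i > 0"
  using v_max_pos gamma_src_pos by (simp add: q_of_def)

lemma q_LB_pos:
  assumes "constrained P \<longrightarrow> is_multiplier P \<gamma>" "i \<in> src"
  shows "q_LB P \<gamma> i > 0"
  using assms q_of_pos v_max_pos by (auto simp: q_LB_def is_multiplier_def)

text \<open>All rates are nonincreasing in \<open>\<gamma>\<close>, so two equal values of
  \<open>S_of\<close> force equality term by term. The multiplier itself can be ambiguous, since
  every rate stays at \<open>v_max\<close> for small \<open>\<gamma>\<close>.\<close>

lemma q_of_multiplier_unique:
  assumes "is_multiplier P \<gamma>" "is_multiplier P \<gamma>'" "i \<in> src"
  shows "q_of P \<gamma> i = q_of P \<gamma>' i"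
proof -
  have *: "q_of P \<gamma> i = q_of P \<gamma>' i"
    if m: "is_multiplier P \<gamma>" "is_multiplier P \<gamma>'" and le: "\<gamma> \<le> \<gamma>'" for \<gamma> \<gamma>'
  proof -
    let ?d = "\<lambda>i. (q_of P \<gamma> i - q_of P \<gamma>' i) / (pS P i * pD P i)"
    have "0 \<le> ?d j" if "j \<in> src" for j
      using q_of_antimono[of \<gamma> \<gamma>' P j] m le v_max_pos[OF that] gamma_src_pos[OF that] p_pos[OF that]
      by (simp add: is_multiplier_def)
    moreover have "(\<Sum>j\<in>src. ?d j) = 0"
      using m by (simp add: is_multiplier_def S_of_def diff_divide_distrib sum_subtractf)
    ultimately have "?d i = 0"
      using sum_nonneg_eq_0_iff[of src ?d] assms(3) by blast
    then show ?thesis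
      using p_pos[OF assms(3)] by auto
  qed
  show ?thesis
    using *[of \<gamma> \<gamma>'] *[of \<gamma>' \<gamma>] assms by (metis linear)
qed

text \<open>Intermediate value theorem for \<open>S_of\<close>, which is at least the capacity at a
  small argument and tends to 0 at infinity.\<close>

lemma multiplier_exists:
  assumes "constrained P"
  shows "\<exists>\<gamma>. is_multiplier P \<gamma>"
proof -
  \<comment> \<open>Up to the smallest \<open>gamma_src\<close> no rate is reduced below
    \<open>v_max\<close>, so \<open>S_of P lo\<close> is the sum in
    \<open>constrained\<close>.\<close>
  define lo where "lo = Min (gamma_src P ` src)"
  have ne: "src \<noteq> {}"
    using num_src_pos by (auto simp: Suc_le_eq)
  have lo_pos: "lo > 0"
    unfolding lo_def using ne gamma_src_pos by (subst Min_gr_iff) auto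
  have lo_le: "lo \<le> gamma_src P i" if "i \<in> src" for i
    unfolding lo_def using that by (intro Min_le) auto
  have q_lo: "q_of P lo i = v_max P i" if "i \<in> src" for i
    using lo_le[OF that] lo_pos by (simp add: q_of_def min_def)
  have "S_of P lo = (\<Sum>i\<in>src. v_max P i / (pS P i * pD P i))"
    unfolding S_of_def by (intro sum.cong) (simp_all add: q_lo)
  with assms have S_lo: "S_of P lo \<ge> real (capacity P)"
    by (simp add: constrained_def)
  have "((\<lambda>\<gamma>. S_of P \<gamma>) \<longlongrightarrow> (\<Sum>i\<in>src. v_max P i * min 1 (sqrt 0) / (pS P i * pD P i))) at_top"
    unfolding S_of_def q_of_def using p_pos
    by (intro tendsto_intros tendsto_divide_0[OF tendsto_const]
          filterlim_at_top_imp_at_infinity[OF filterlim_ident]) (force intro: less_imp_neq)+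
  then have "(S_of P \<longlongrightarrow> 0) at_top"
    by simp
  then have "eventually (\<lambda>\<gamma>. S_of P \<gamma> < real (capacity P)) at_top"
    using capacity_bounds by (intro order_tendstoD) auto
  then have "eventually (\<lambda>\<gamma>. S_of P \<gamma> < real (capacity P) \<and> lo \<le> \<gamma>) at_top"
    by (intro eventually_conj eventually_ge_at_top)
  then obtain hi where hi: "S_of P hi < real (capacity P)" "lo \<le> hi"
    by (auto simp: eventually_at_top_linorder)
  have "continuous_on {lo..hi} (S_of P)"
    unfolding S_of_def q_of_def using lo_pos p_pos
    by (intro continuous_intros) (force intro: less_imp_neq)+
  then obtain \<gamma> where "lo \<le> \<gamma>" "S_of P \<gamma> = real (capacity P)"
    using IVT2'[of "S_of P" hi "real (capacity P)" lo] hi S_lo by auto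
  then show ?thesis
    using lo_pos unfolding is_multiplier_def by (meson less_le_trans)
qed

text \<open>
  This is weak duality: the weight \<open>wt P i / q\<^sup>2\<close> dominates the price \<open>2 N \<gamma> / (p\<^sup>S p\<^sup>D)\<close> of the
  capacity constraint, with equality unless the constraint \<open>q \<le> v\<close> is tight.
\<close>

lemma weighted_rate_bound:
  fixes g B :: "nat \<Rightarrow> real" and T :: real
  assumes mult: "constrained P \<longrightarrow> is_multiplier P \<gamma>"
    and g_le: "\<And>i. i \<in> src \<Longrightarrow> g i \<le> v_max P i * T + B i"
    and B_nonneg: "\<And>i. i \<in> src \<Longrightarrow> B i \<ge> 0"
    and cap: "(\<Sum>i\<in>src. g i / (pS P i * pD P i)) \<le> T * real (capacity P)"
  shows "(\<Sum>i\<in>src. wt P i / (q_LB P \<gamma> i)\<^sup>2 * g i)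
    \<le> T * (\<Sum>i\<in>src. wt P i / q_LB P \<gamma> i) + (\<Sum>i\<in>src. wt P i / (q_LB P \<gamma> i)\<^sup>2 * B i)"
proof -
  define \<mu> where "\<mu> = (if constrained P then 2 * real (num_src P) * \<gamma> else 0)"
  have \<mu>_nonneg: "\<mu> \<ge> 0"
    using mult by (auto simp: \<mu>_def is_multiplier_def)
  have key: "wt P i / (q_LB P \<gamma> i)\<^sup>2 * g i \<le> T * (wt P i / q_LB P \<gamma> i)
      + wt P i / (q_LB P \<gamma> i)\<^sup>2 * B i + \<mu> * ((g i - q_LB P \<gamma> i * T) / (pS P i * pD P i))"
    if i: "i \<in> src" for i
  proof -
    define p q v w m where pqv: "p = pS P i * pD P i" "q = q_LB P \<gamma> i" "v = v_max P i"
      "w = wt P i / q\<^sup>2" "m = \<mu> / p"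
    have pos: "p > 0" "q > 0" "v > 0" "wt P i > 0" "w > 0" "m \<ge> 0"
      using p_pos[OF i] q_LB_pos[OF mult i] v_max_pos[OF i] wt_pos[OF i] \<mu>_nonneg
      by (auto simp: pqv)
    \<comment> \<open>The optimality conditions: \<open>w\<close> and the price \<open>m\<close>
      agree unless the rate sits at its cap, where \<open>w\<close> may only be larger.\<close>
    have wm: "m \<le> w \<and> (m = w \<or> q = v)"
    proof (cases "constrained P")
      case False
      then show ?thesis
        using pos by (simp add: pqv \<mu>_def q_LB_def)
    next
      case True
      then have \<gamma>: "\<gamma> > 0"
        using mult by (simp add: is_multiplier_def)
      define s where "s = sqrt (gamma_src P i / \<gamma>)"
      have s: "s > 0"
        unfolding s_def using gamma_src_pos[OF i] \<gamma> by simp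
      \<comment> \<open>\<open>gamma_src\<close> is normalized so that \<open>v^2\<close> cancels
        here: the interior rate \<open>v * s\<close> solves \<open>wt P i / q^2 = m\<close>.\<close>
      have s2: "v\<^sup>2 * s\<^sup>2 = wt P i * p / (2 * real (num_src P) * \<gamma>)"
      proof -
        have "s\<^sup>2 = gamma_src P i / \<gamma>"
          unfolding s_def using gamma_src_pos[OF i] \<gamma> by simp
        then show ?thesis
          using pos(3) by (simp add: gamma_src_def pqv(1) pqv(3)[symmetric] mult.assoc)
      qed
      have q: "q = v * min 1 s"
        using True by (simp add: pqv q_LB_def q_of_def s_def)
      have m: "m * (v\<^sup>2 * s\<^sup>2) = wt P i"
        unfolding s2 using pos(1) \<gamma> num_src_pos True by (simp add: pqv(5) \<mu>_def)
      have "q\<^sup>2 \<le> v\<^sup>2 * s\<^sup>2"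
        unfolding q power_mult_distrib using s by (intro mult_left_mono power_mono) auto
      then have "m * q\<^sup>2 \<le> wt P i"
        using m pos(6) by (metis mult_left_mono)
      then have "m \<le> w"
        using pos by (simp add: pqv(4) field_simps)
      moreover have "m = w" if "q \<noteq> v"
      proof -
        have "q = v * s"
          using q that by (auto simp: min_def split: if_splits)
        then have "m * q\<^sup>2 = wt P i"
          using m by (simp add: power_mult_distrib)
        then show ?thesis
          using pos by (simp add: pqv(4) field_simps)
      qed
      ultimately show ?thesis
        by blast
    qed
    \<comment> \<open>If \<open>q = v\<close>, the rate bound on \<open>g i\<close> leaves only the
      slack \<open>B i\<close>; otherwise \<open>w = m\<close> and the left side vanishes.\<close>
    have "(w - m) * (g i - q * T) \<le> w * B i"
    proof (cases "q = v")
      case True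
      have "(w - m) * (g i - q * T) \<le> (w - m) * B i"
        using g_le[OF i] wm True by (intro mult_left_mono) (auto simp: pqv(3))
      also have "\<dots> \<le> w * B i"
        using pos B_nonneg[OF i] by (intro mult_right_mono) auto
      finally show ?thesis .
    next
      case False
      then show ?thesis
        using wm pos B_nonneg[OF i] by simp
    qed
    then have "w * g i \<le> T * (w * q) + w * B i + m * (g i - q * T)"
      by (simp add: algebra_simps)
    moreover have "w * q = wt P i / q"
      using pos by (simp add: pqv(4) power2_eq_square)
    ultimately have "w * g i \<le> T * (wt P i / q) + w * B i + \<mu> * ((g i - q * T) / p)"
      by (simp add: pqv(5))
    then show ?thesis
      by (simp only: pqv)
  qed
  have "(\<Sum>i\<in>src. wt P i / (q_LB P \<gamma> i)\<^sup>2 * g i) \<le> (\<Sum>i\<in>src. T * (wt P i / q_LB P \<gamma> i)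
      + wt P i / (q_LB P \<gamma> i)\<^sup>2 * B i + \<mu> * ((g i - q_LB P \<gamma> i * T) / (pS P i * pD P i)))"
    by (intro sum_mono key)
  also have "\<dots> = T * (\<Sum>i\<in>src. wt P i / q_LB P \<gamma> i)
      + (\<Sum>i\<in>src. wt P i / (q_LB P \<gamma> i)\<^sup>2 * B i)
      + \<mu> * (\<Sum>i\<in>src. (g i - q_LB P \<gamma> i * T) / (pS P i * pD P i))"
    by (simp add: sum.distrib sum_distrib_left)
  \<comment> \<open>When the price is positive the optimal rates exhaust the capacity, so no
    admissible \<open>g\<close> can use more than they do.\<close>
  also have "\<mu> * (\<Sum>i\<in>src. (g i - q_LB P \<gamma> i * T) / (pS P i * pD P i)) \<le> 0"
  proof (cases "constrained P")
    case True
    have "(\<Sum>i\<in>src. (g i - q_LB P \<gamma> i * T) / (pS P i * pD P i))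
        = (\<Sum>i\<in>src. g i / (pS P i * pD P i)) - T * (\<Sum>i\<in>src. q_LB P \<gamma> i / (pS P i * pD P i))"
      by (simp add: diff_divide_distrib sum_subtractf sum_distrib_left mult.commute)
    also have "(\<Sum>i\<in>src. q_LB P \<gamma> i / (pS P i * pD P i)) = real (capacity P)"
      using mult True by (simp add: is_multiplier_def S_of_def q_LB_def)
    finally have "(\<Sum>i\<in>src. (g i - q_LB P \<gamma> i * T) / (pS P i * pD P i)) \<le> 0"
      using cap by simp
    then show ?thesis
      using \<mu>_nonneg by (simp add: mult_nonneg_nonpos)
  qed (simp add: \<mu>_def)
  finally show ?thesis
    by simp
qed

end

section \<open>Independence of the inputs\<close>

text \<open>A countable union over the index of the generation. The measure is arbitrary so that the
  lemma also covers sub-algebras generated by some of the inputs.\<close>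

lemma generation_sets:
  assumes "\<And>k. Y k \<in> measurable N (count_space (UNIV :: nat set))"
  shows "{\<omega> \<in> space N. generation (\<lambda>k. Y k \<omega>) s = 1} \<in> sets N"
proof -
  have [measurable]: "Y k \<in> measurable N (count_space UNIV)" for k
    by (fact assms)
  have "{\<omega> \<in> space N. generation (\<lambda>k. Y k \<omega>) s = 1}
      = (\<Union>n. {\<omega> \<in> space N. s = 1 + (\<Sum>k<n. Y k \<omega>)})"
    by (auto simp: generation_def)
  also have "\<dots> \<in> sets N"
    by measurable
  finally show ?thesis .
qed

context aoi_network
begin

abbreviation "events_of \<equiv> input_events M X cS cD R W"

text \<open>The information carried by a block of inputs. Independence claims then reduce to finding
  disjoint blocks that determine the events in question.\<close>

definition inputs_algebra :: "input set \<Rightarrow> 'a measure" where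
  "inputs_algebra I = sigma (space M) (\<Union>j\<in>I. events_of j)"

lemma events_of_subset_Pow: "(\<Union>j\<in>I. events_of j) \<subseteq> Pow (space M)"
proof -
  have "events_of j \<subseteq> Pow (space M)" for j
    by (cases j) auto
  then show ?thesis
    by blast
qed

lemma space_inputs_algebra [simp]: "space (inputs_algebra I) = space M"
  unfolding inputs_algebra_def using events_of_subset_Pow by (rule space_measure_of)

lemma sets_inputs_algebra: "sets (inputs_algebra I) = sigma_sets (space M) (\<Union>j\<in>I. events_of j)"
  unfolding inputs_algebra_def using events_of_subset_Pow by (rule sets_measure_of)

lemma inputs_algebra_event: "j \<in> I \<Longrightarrow> A \<in> events_of j \<Longrightarrow> A \<in> sets (inputs_algebra I)"
  unfolding sets_inputs_algebra by (intro sigma_sets.Basic) auto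

lemma events_of_events: "j \<in> inputs P \<Longrightarrow> events_of j \<subseteq> events"
  using inputs_indep by (simp add: indep_sets_def)

lemma sets_inputs_algebra_subset: "I \<subseteq> inputs P \<Longrightarrow> sets (inputs_algebra I) \<subseteq> events"
  unfolding sets_inputs_algebra using events_of_events by (intro sets.sigma_sets_subset) blast

text \<open>Generators closed under intersection let independence pass to the generated
  algebras.\<close>

lemma Int_stable_events_of: "Int_stable (events_of j)"
proof -
  have *: "Int_stable {f -` A \<inter> space M |A. A \<in> \<A>}"
    if "\<And>A B. A \<in> \<A> \<Longrightarrow> B \<in> \<A> \<Longrightarrow> A \<inter> B \<in> \<A>" for f :: "'a \<Rightarrow> 'c" and \<A>
    unfolding Int_stable_def
  proof (intro ballI)
    fix a b assume "a \<in> {f -` A \<inter> space M |A. A \<in> \<A>}" "b \<in> {f -` A \<inter> space M |A. A \<in> \<A>}"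
    then obtain A B where "A \<in> \<A>" "B \<in> \<A>" "a = f -` A \<inter> space M" "b = f -` B \<inter> space M"
      by blast
    then show "a \<inter> b \<in> {f -` A \<inter> space M |A. A \<in> \<A>}"
      using that by (intro CollectI exI[of _ "A \<inter> B"]) auto
  qed
  show ?thesis
  proof (cases j)
    case Seed
    show ?thesis
      unfolding Seed input_events.simps by (rule *) auto
  qed (simp_all only: input_events.simps, (rule *; simp)+)
qed

lemma indep_inputs_algebra:
  assumes "I \<subseteq> inputs P" "I' \<subseteq> inputs P" "I \<inter> I' = {}"
  shows "indep_set (sets (inputs_algebra I)) (sets (inputs_algebra I'))"
proof -
  have "indep_sets (\<lambda>j. sigma_sets (space M) (\<Union>i\<in>case_bool I I' j. events_of i)) UNIV"
  proof (rule indep_sets_collect_sigma)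
    show "indep_sets events_of (\<Union>j\<in>UNIV. case_bool I I' j)"
      using assms by (intro indep_sets_mono_index[OF _ inputs_indep]) (auto split: bool.splits)
    show "disjoint_family_on (case_bool I I') UNIV"
      using assms by (auto simp: disjoint_family_on_def split: bool.splits)
  qed (rule Int_stable_events_of)
  moreover have "(\<lambda>j. sigma_sets (space M) (\<Union>i\<in>case_bool I I' j. events_of i))
      = case_bool (sets (inputs_algebra I)) (sets (inputs_algebra I'))"
    by (auto simp: sets_inputs_algebra fun_eq_iff split: bool.splits)
  ultimately show ?thesis
    by (simp add: indep_set_def)
qed

lemma indep_var_inputs_algebra:
  fixes f g :: "'a \<Rightarrow> real"
  assumes I: "I \<subseteq> inputs P" "I' \<subseteq> inputs P" "I \<inter> I' = {}"
    and f: "f \<in> borel_measurable (inputs_algebra I)"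
    and g: "g \<in> borel_measurable (inputs_algebra I')"
  shows "indep_var borel f borel g"
proof -
  have sub: "sigma_sets (space M) {h -` A \<inter> space M |A. A \<in> sets borel} \<subseteq> sets (inputs_algebra J)"
    if "h \<in> borel_measurable (inputs_algebra J)" for h :: "'a \<Rightarrow> real" and J
  proof -
    have "sigma_sets (space (inputs_algebra J)) {h -` A \<inter> space M |A. A \<in> sets borel} \<subseteq> sets (inputs_algebra J)"
      using measurable_sets[OF that] by (intro sets.sigma_sets_subset) auto
    then show ?thesis
      by simp
  qed
  have "random_variable borel h" if h: "h \<in> borel_measurable (inputs_algebra J)" and J: "J \<subseteq> inputs P"
    for h :: "'a \<Rightarrow> real" and J
  proof (rule measurableI)
    fix A :: "real set" assume "A \<in> sets borel"
    then have "h -` A \<inter> space M \<in> sets (inputs_algebra J)"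
      using measurable_sets[OF h] by simp
    then show "h -` A \<inter> space M \<in> events"
      using sets_inputs_algebra_subset[OF J] by blast
  qed simp
  then have "random_variable borel f" "random_variable borel g"
    using f g I by blast+
  moreover have "indep_set (sigma_sets (space M) {f -` A \<inter> space M |A. A \<in> sets borel})
      (sigma_sets (space M) {g -` A \<inter> space M |A. A \<in> sets borel})"
    using indep_inputs_algebra[OF I] sub[OF f] sub[OF g] unfolding indep_sets2_eq by blast
  ultimately show ?thesis
    by (simp add: indep_var_eq)
qed

lemma X_measurable_inputs_algebra:
  "Period i k \<in> I \<Longrightarrow> X i k \<in> measurable (inputs_algebra I) (count_space UNIV)"
proof (rule measurableI)
  fix A assume "Period i k \<in> I"
  then show "X i k -` A \<inter> space (inputs_algebra I) \<in> sets (inputs_algebra I)"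
    by (rule inputs_algebra_event) auto
qed simp

lemma Period_inputs: "i \<in> src \<Longrightarrow> Period i k \<in> inputs P"
  by (auto simp: inputs_def)

section \<open>The expected number of generations\<close>

lemma integrable_indicator_event: "A \<in> events \<Longrightarrow> integrable M (indicator A :: 'a \<Rightarrow> real)"
  by (intro integrable_real_indicator) (simp_all add: emeasure_eq_measure)

text \<open>Wald's identity: the probability that a period is started by time \<open>T\<close> is
  \<open>gen_rate\<close> times the expectation of that period on this event. Summed over the
  periods this is a stopped sum, at most \<open>T + max_gap\<close> on almost every path.\<close>

lemma generations_expectation:
  assumes i: "i \<in> src"
  shows "expectation (\<lambda>\<omega>. real (card {s \<in> {1..T}. generation (\<lambda>k. X i k \<omega>) s = 1}))
    \<le> gen_rate P i * (real T + real (max_gap P i))"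
proof -
  note [measurable] = X_measurable[OF i]
  let ?S = "\<lambda>n \<omega>. \<Sum>k<n. X i k \<omega>"
  let ?B = "\<lambda>n. {\<omega> \<in> space M. ?S n \<omega> < T}"
  have B: "?B n \<in> events" for n
    by measurable
  \<comment> \<open>Whether the \<open>n\<close>-th generation happens by time \<open>T\<close> depends only on the earlier periods.\<close>
  have wald: "prob (?B n) = gen_rate P i * expectation (\<lambda>\<omega>. real (X i n \<omega>) * indicator (?B n) \<omega>)" for n
  proof -
    have "indep_var borel (\<lambda>\<omega>. real (X i n \<omega>)) borel (indicator (?B n) :: 'a \<Rightarrow> real)"
    proof (rule indep_var_inputs_algebra)
      show "{Period i n} \<subseteq> inputs P" "Period i ` {..<n} \<subseteq> inputs P"
        using Period_inputs[OF i] by auto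
      have [measurable]: "X i n \<in> measurable (inputs_algebra {Period i n}) (count_space UNIV)"
        by (intro X_measurable_inputs_algebra) auto
      show "(\<lambda>\<omega>. real (X i n \<omega>)) \<in> borel_measurable (inputs_algebra {Period i n})"
        by measurable
      let ?N = "inputs_algebra (Period i ` {..<n})"
      have "?S n \<in> measurable ?N (count_space UNIV)"
        by (intro measurable_sum_nat X_measurable_inputs_algebra) auto
      then have "?S n -` {..<T} \<inter> space ?N \<in> sets ?N"
        by (rule measurable_sets) simp
      also have "?S n -` {..<T} \<inter> space ?N = ?B n"
        by auto
      finally show "(indicator (?B n) :: 'a \<Rightarrow> real) \<in> borel_measurable ?N"
        by (rule borel_measurable_indicator)
    qed auto
    then have "expectation (\<lambda>\<omega>. real (X i n \<omega>) * indicator (?B n) \<omega>)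
        = expectation (\<lambda>\<omega>. real (X i n \<omega>)) * expectation (indicator (?B n))"
      by (rule indep_var_lebesgue_integral) (intro X_integrable i integrable_indicator_event B)+
    then show ?thesis
      using X_expectation[OF i] gen_rate_pos[OF i] by simp
  qed
  have int: "integrable M (\<lambda>\<omega>. real (X i n \<omega>) * indicator (?B n) \<omega>)" for n
    by (intro integrable_real_mult_indicator X_integrable i) measurable
  have "expectation (\<lambda>\<omega>. real (card {s \<in> {1..T}. generation (\<lambda>k. X i k \<omega>) s = 1}))
    \<le> expectation (\<lambda>\<omega>. \<Sum>n<T. indicator (?B n) \<omega>)"
  proof (rule integral_mono_AE')
    show "integrable M (\<lambda>\<omega>. \<Sum>n<T. indicator (?B n) \<omega> :: real)"
      by (intro Bochner_Integration.integrable_sum integrable_indicator_event B)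
    show "AE \<omega> in M. real (card {s \<in> {1..T}. generation (\<lambda>k. X i k \<omega>) s = 1}) \<le> (\<Sum>n<T. indicator (?B n) \<omega>)"
      using AE_X_range[OF i] AE_space
    proof eventually_elim
      case (elim \<omega>)
      then have "real (card {s \<in> {1..T}. generation (\<lambda>k. X i k \<omega>) s = 1})
          \<le> real (card {n \<in> {..<T}. ?S n \<omega> < T})"
        by (intro of_nat_mono generations_le_renewals) auto
      also have "\<dots> = (\<Sum>n<T. indicator (?B n) \<omega>)"
        using elim by (simp add: indicator_def sum.If_cases Int_def)
      finally show ?case .
    qed
  qed (simp add: sum_nonneg)
  also have "\<dots> = (\<Sum>n<T. prob (?B n))"
    by (rule trans[OF Bochner_Integration.integral_sum])
      (rule integrable_indicator_event, rule B, simp)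
  also have "\<dots> = gen_rate P i * expectation (\<lambda>\<omega>. \<Sum>n<T. real (X i n \<omega>) * indicator (?B n) \<omega>)"
    unfolding wald sum_distrib_left[symmetric]
    by (subst Bochner_Integration.integral_sum) (simp_all add: int)
  also have "expectation (\<lambda>\<omega>. \<Sum>n<T. real (X i n \<omega>) * indicator (?B n) \<omega>) \<le> real T + real (max_gap P i)"
  proof (rule integral_le_const)
    show "integrable M (\<lambda>\<omega>. \<Sum>n<T. real (X i n \<omega>) * indicator (?B n) \<omega>)"
      by (intro Bochner_Integration.integrable_sum int)
    show "AE \<omega> in M. (\<Sum>n<T. real (X i n \<omega>) * indicator (?B n) \<omega>) \<le> real T + real (max_gap P i)"
      using AE_X_range[OF i] AE_space
    proof eventually_elim
      case (elim \<omega>)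
      then have "(\<Sum>n<T. real (X i n \<omega>) * indicator (?B n) \<omega>)
          = real (\<Sum>n<T. if ?S n \<omega> < T then X i n \<omega> else 0)"
        unfolding of_nat_sum by (intro sum.cong) (simp_all add: indicator_def)
      also have "\<dots> \<le> real (T + max_gap P i)"
        using elim by (intro of_nat_mono renewal_overshoot) auto
      finally show ?case
        by simp
    qed
  qed
  finally show ?thesis
    using gen_rate_pos[OF i] by simp
qed

section \<open>Policies\<close>

text \<open>Here non-anticipation enters: nothing known before deciding in slot \<open>t\<close>
  involves the channels of source \<open>i\<close> in that slot. All periods may stay in the block,
  since only independence from these two channels is wanted.\<close>

lemma sets_info_subset:
  assumes i: "i \<in> src"
  shows "sets (info P M X cS cD R W t)
    \<subseteq> sets (inputs_algebra (inputs P - {ChannelS i t, ChannelD i t}))"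
proof -
  let ?I = "inputs P - {ChannelS i t, ChannelD i t}"
  let ?N = "inputs_algebra ?I"
  have "W -` A \<inter> space M \<in> sets ?N" if "A \<in> sets R" for A
    using that by (intro inputs_algebra_event[of Seed]) (auto simp: inputs_def)
  moreover have "{\<omega> \<in> space M. generation (\<lambda>k. X j k \<omega>) s = 1} \<in> sets ?N" if "j \<in> src" for j s
    using generation_sets[of "X j" ?N s] X_measurable_inputs_algebra[of j _ ?I] Period_inputs[OF that]
    by simp
  moreover have "{\<omega> \<in> space M. cS j s \<omega> = 1} \<in> sets ?N" if "j \<in> src" "1 \<le> s" "s < t" for j s
    using that by (intro inputs_algebra_event[of "ChannelS j s"])
      (auto simp: inputs_def vimage_def intro!: exI[of _ "{1}"])
  moreover have "{\<omega> \<in> space M. cD j s \<omega> = 1} \<in> sets ?N" if "j \<in> src" "1 \<le> s" "s < t" for j s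
    using that by (intro inputs_algebra_event[of "ChannelD j s"])
      (auto simp: inputs_def vimage_def intro!: exI[of _ "{1}"])
  ultimately have "sigma_sets (space ?N)
     ({W -` A \<inter> space M |A. A \<in> sets R}
      \<union> {{\<omega> \<in> space M. generation (\<lambda>k. X i k \<omega>) s = 1} |i s. i \<in> src \<and> 1 \<le> s \<and> s \<le> t}
      \<union> {{\<omega> \<in> space M. cS i s \<omega> = 1} |i s. i \<in> src \<and> 1 \<le> s \<and> s < t}
      \<union> {{\<omega> \<in> space M. cD i s \<omega> = 1} |i s. i \<in> src \<and> 1 \<le> s \<and> s < t}) \<subseteq> sets ?N"
    by (intro sets.sigma_sets_subset) blast
  then show ?thesis
    unfolding info_def by (subst sets_measure_of) auto
qed

lemma space_info [simp]: "space (info P M X cS cD R W t) = space M"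
  unfolding info_def by (rule space_measure_of) auto

lemma policy_event:
  assumes "u \<in> policies P M X cS cD R W" "i \<in> src" "t \<ge> 1"
  shows "u i t -` A \<inter> space M \<in> sets (inputs_algebra (inputs P - {ChannelS i t, ChannelD i t}))"
proof -
  have "u i t \<in> measurable (info P M X cS cD R W t) (count_space UNIV)"
    using assms by (simp add: policies_def)
  then have "u i t -` A \<inter> space M \<in> sets (info P M X cS cD R W t)"
    using measurable_sets[of "u i t" "info P M X cS cD R W t" "count_space UNIV" A] by simp
  then show ?thesis
    using sets_info_subset[OF assms(2)] by blast
qed

lemma policy_measurable:
  assumes "u \<in> policies P M X cS cD R W" "i \<in> src" "t \<ge> 1"
  shows "u i t \<in> measurable M (count_space UNIV)"
  using policy_event[OF assms] sets_inputs_algebra_subset[of "inputs P - {ChannelS i t, ChannelD i t}"]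
  by (intro measurableI) auto

lemma policy_values:
  assumes "u \<in> policies P M X cS cD R W" "i \<in> src" "t \<ge> 1" "\<omega> \<in> space M"
  shows "u i t \<omega> \<in> {0, 1}"
  using assms by (simp add: policies_def)

lemma policy_capacity:
  assumes "u \<in> policies P M X cS cD R W" "t \<ge> 1" "\<omega> \<in> space M"
  shows "(\<Sum>i\<in>src. u i t \<omega>) \<le> capacity P"
  using assms by (simp add: policies_def)

text \<open>Two uses of independence: the decision is independent of the pair of channels, and these
  are independent of each other.\<close>

lemma prob_success:
  assumes u: "u \<in> policies P M X cS cD R W" "i \<in> src" "t \<ge> 1"
  shows "prob {\<omega> \<in> space M. u i t \<omega> * cS i t \<omega> * cD i t \<omega> = 1}
    = pS P i * pD P i * expectation (\<lambda>\<omega>. real (u i t \<omega>))"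
proof -
  let ?U = "u i t -` {1} \<inter> space M"
  let ?S = "cS i t -` {1} \<inter> space M" and ?D = "cD i t -` {1} \<inter> space M"
  let ?I = "inputs P - {ChannelS i t, ChannelD i t}"
  have in_inputs: "ChannelS i t \<in> inputs P" "ChannelD i t \<in> inputs P"
    using u by (auto simp: inputs_def)
  have U: "?U \<in> sets (inputs_algebra ?I)"
    by (rule policy_event[OF u])
  have S: "?S \<in> sets (inputs_algebra J)" if "ChannelS i t \<in> J" for J
    by (rule inputs_algebra_event[OF that]) auto
  have D: "?D \<in> sets (inputs_algebra J)" if "ChannelD i t \<in> J" for J
    by (rule inputs_algebra_event[OF that]) auto
  have "prob (?S \<inter> ?D) = prob ?S * prob ?D"
    by (rule indep_setD[OF indep_inputs_algebra[of "{ChannelS i t}" "{ChannelD i t}"]])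
      (use in_inputs S D in auto)
  moreover have "prob (?U \<inter> (?S \<inter> ?D)) = prob ?U * prob (?S \<inter> ?D)"
    by (rule indep_setD[OF indep_inputs_algebra[of ?I "{ChannelS i t, ChannelD i t}"]])
      (use in_inputs U S D in auto)
  moreover have "{\<omega> \<in> space M. u i t \<omega> * cS i t \<omega> * cD i t \<omega> = 1} = ?U \<inter> (?S \<inter> ?D)"
    by auto
  moreover have "prob ?S = pS P i"
    using cS_prob[OF u(2,3)] by (simp add: vimage_def Int_def conj_commute)
  moreover have "prob ?D = pD P i"
    using cD_prob[OF u(2,3)] by (simp add: vimage_def Int_def conj_commute)
  moreover have "expectation (\<lambda>\<omega>. real (u i t \<omega>)) = prob ?U"
  proof -
    have "expectation (\<lambda>\<omega>. real (u i t \<omega>)) = expectation (indicator ?U)"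
      using policy_values[OF u] by (intro Bochner_Integration.integral_cong) (auto simp: indicator_def)
    then show ?thesis
      using policy_measurable[OF u] by (simp add: measurable_sets)
  qed
  ultimately show ?thesis
    by simp
qed

lemma expected_successes:
  assumes u: "u \<in> policies P M X cS cD R W" "i \<in> src"
  shows "expectation (\<lambda>\<omega>. real (card {t \<in> {1..T}. u i t \<omega> * cS i t \<omega> * cD i t \<omega> = 1}))
    = pS P i * pD P i * (\<Sum>t=1..T. expectation (\<lambda>\<omega>. real (u i t \<omega>)))" (is "?lhs = _")
    and "integrable M (\<lambda>\<omega>. real (card {t \<in> {1..T}. u i t \<omega> * cS i t \<omega> * cD i t \<omega> = 1}))"
proof -
  let ?B = "\<lambda>t. {\<omega> \<in> space M. u i t \<omega> * cS i t \<omega> * cD i t \<omega> = 1}"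
  have B: "?B t \<in> events" if "t \<in> {1..T}" for t
  proof -
    have "1 \<le> t"
      using that by simp
    note [measurable] = policy_measurable[OF u this] cS_measurable[OF u(2) this] cD_measurable[OF u(2) this]
    show ?thesis
      by measurable
  qed
  have eq: "real (card {t \<in> {1..T}. u i t \<omega> * cS i t \<omega> * cD i t \<omega> = 1}) = (\<Sum>t=1..T. indicator (?B t) \<omega>)"
    if "\<omega> \<in> space M" for \<omega>
    using that by (simp add: indicator_def sum.If_cases Int_def)
  have int: "integrable M (indicator (?B t) :: 'a \<Rightarrow> real)" if "t \<in> {1..T}" for t
    using B[OF that] by (rule integrable_indicator_event)
  have "?lhs = expectation (\<lambda>\<omega>. \<Sum>t=1..T. indicator (?B t) \<omega>)"
    using eq by (intro Bochner_Integration.integral_cong) auto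
  also have "\<dots> = (\<Sum>t=1..T. prob (?B t))"
    using B by (intro trans[OF Bochner_Integration.integral_sum] int) simp_all
  also have "\<dots> = (\<Sum>t=1..T. pS P i * pD P i * expectation (\<lambda>\<omega>. real (u i t \<omega>)))"
    using prob_success[OF u] by (intro sum.cong) auto
  finally show "?lhs = pS P i * pD P i * (\<Sum>t=1..T. expectation (\<lambda>\<omega>. real (u i t \<omega>)))"
    by (simp add: sum_distrib_left)
  show "integrable M (\<lambda>\<omega>. real (card {t \<in> {1..T}. u i t \<omega> * cS i t \<omega> * cD i t \<omega> = 1}))"
    using int by (subst Bochner_Integration.integrable_cong[OF refl eq])
      (auto intro!: Bochner_Integration.integrable_sum)
qed

section \<open>The expected age\<close>

text \<open>The recursion avoids the maximum over a random set in \<open>last_gen\<close>.\<close>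

lemma system_time_measurable:
  assumes i: "i \<in> src"
  shows "(\<lambda>\<omega>. system_time (\<lambda>k. X i k \<omega>) t) \<in> measurable M (count_space UNIV)"
proof (induction t)
  case 0
  then show ?case
    by (simp add: system_time_def)
next
  case (Suc t)
  note [measurable] = Suc
  have [measurable]: "{\<omega> \<in> space M. generation (\<lambda>k. X i k \<omega>) (Suc t) = 1} \<in> events"
    by (rule generation_sets[OF X_measurable[OF i]])
  show ?case
  proof (cases "t = 0")
    case True
    then show ?thesis
      by (simp add: system_time_1)
  next
    case False
    then have "(\<lambda>\<omega>. system_time (\<lambda>k. X i k \<omega>) (Suc t))
        = (\<lambda>\<omega>. if generation (\<lambda>k. X i k \<omega>) (Suc t) = 1 then 0 else system_time (\<lambda>k. X i k \<omega>) t + 1)"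
      by (simp add: system_time_Suc)
    also have "\<dots> \<in> measurable M (count_space UNIV)"
      by measurable
    finally show ?thesis .
  qed
qed

lemma age_measurable:
  assumes u: "u \<in> policies P M X cS cD R W" "i \<in> src"
  shows "age P X cS cD u i t \<in> measurable M (count_space UNIV)"
proof (induction t)
  case 0
  then show ?case
    by (simp add: age_def[abs_def])
next
  case (Suc t)
  show ?case
  proof (cases "t = 0")
    case True
    then show ?thesis
      by (simp add: age_def[abs_def])
  next
    case False
    note [measurable] = Suc system_time_measurable[OF u(2)]
    let ?del = "\<lambda>\<omega>. delivery (delay P i) (\<lambda>s. u i s \<omega>) (\<lambda>s. cS i s \<omega>) (\<lambda>s. cD i s \<omega>) t"
    have [measurable]: "?del \<in> measurable M (count_space UNIV)"
    proof (cases "t > delay P i")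
      case True
      \<comment> \<open>Decisions and channels are known to be measurable from slot 1 on.\<close>
      then have "1 \<le> t - delay P i"
        by simp
      note [measurable] = policy_measurable[OF u this] cS_measurable[OF u(2) this] cD_measurable[OF u(2) this]
      show ?thesis
        using True unfolding delivery_def by simp
    qed (simp add: delivery_def)
    have "age P X cS cD u i (Suc t) = (\<lambda>\<omega>. if ?del \<omega> = 1
        then system_time (\<lambda>k. X i k \<omega>) (t - delay P i) + delay P i + 1 else age P X cS cD u i t \<omega> + 1)"
      using False by (simp add: age_def fun_eq_iff aoi_Suc)
    also have "\<dots> \<in> measurable M (count_space UNIV)"
      by measurable
    finally show ?thesis .
  qed
qed

lemma age_integrable:
  assumes "u \<in> policies P M X cS cD R W" "i \<in> src"
  shows "integrable M (\<lambda>\<omega>. real (age P X cS cD u i t \<omega>))"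
proof (rule integrable_const_bound[where B = "real t"])
  show "AE \<omega> in M. norm (real (age P X cS cD u i t \<omega>)) \<le> real t"
    by (simp add: age_def aoi_le)
  show "(\<lambda>\<omega>. real (age P X cS cD u i t \<omega>)) \<in> borel_measurable M"
    using age_measurable[OF assms, of t] by measurable
qed

section \<open>The expected number of resets\<close>

definition num_resets :: "(nat \<Rightarrow> nat \<Rightarrow> 'a \<Rightarrow> nat) \<Rightarrow> nat \<Rightarrow> nat \<Rightarrow> 'a \<Rightarrow> real" where
  "num_resets u i T \<omega> = real (card (resets (\<lambda>t. age P X cS cD u i t \<omega>) \<inter> {1..<T}))"

lemma num_resets_integrable:
  assumes u: "u \<in> policies P M X cS cD R W" "i \<in> src"
  shows "integrable M (num_resets u i T)"
proof -
  have "num_resets u i T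
      = (\<lambda>\<omega>. \<Sum>t\<in>{1..<T}. if age P X cS cD u i (Suc t) \<omega> \<le> age P X cS cD u i t \<omega> then 1 else 0)"
  proof
    fix \<omega>
    have "resets (\<lambda>t. age P X cS cD u i t \<omega>) \<inter> {1..<T}
        = {1..<T} \<inter> {t. age P X cS cD u i (Suc t) \<omega> \<le> age P X cS cD u i t \<omega>}"
      by (auto simp: resets_def)
    then show "num_resets u i T \<omega>
        = (\<Sum>t\<in>{1..<T}. if age P X cS cD u i (Suc t) \<omega> \<le> age P X cS cD u i t \<omega> then 1 else 0)"
      by (simp add: num_resets_def sum.If_cases)
  qed
  also have "\<dots> \<in> borel_measurable M"
  proof (intro borel_measurable_sum measurable_If)
    fix t
    have "{\<omega> \<in> space M. real (age P X cS cD u i (Suc t) \<omega>) \<le> real (age P X cS cD u i t \<omega>)} \<in> events"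
      by (intro borel_measurable_le borel_measurable_integrable age_integrable[OF u])
    then show "{\<omega> \<in> space M. age P X cS cD u i (Suc t) \<omega> \<le> age P X cS cD u i t \<omega>} \<in> events"
      by simp
  qed simp_all
  finally have "num_resets u i T \<in> borel_measurable M" .
  moreover have "norm (num_resets u i T \<omega>) \<le> real T" for \<omega>
    using card_mono[of "{1..<T}" "resets (\<lambda>t. age P X cS cD u i t \<omega>) \<inter> {1..<T}"]
    by (simp add: num_resets_def)
  ultimately show ?thesis
    by (intro integrable_const_bound[where B = "real T"]) auto
qed

lemma num_resets_le_generations:
  assumes u: "u \<in> policies P M X cS cD R W" "i \<in> src"
  shows "expectation (num_resets u i T) \<le> gen_rate P i * (real T + real (max_gap P i))"
proof -
  let ?G = "\<lambda>\<omega>. real (card {s \<in> {1..T}. generation (\<lambda>k. X i k \<omega>) s = 1})"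
  have eq: "?G \<omega> = (\<Sum>s=1..T. indicator {\<omega> \<in> space M. generation (\<lambda>k. X i k \<omega>) s = 1} \<omega>)"
    if "\<omega> \<in> space M" for \<omega>
    using that by (simp add: indicator_def sum.If_cases Int_def)
  have "{\<omega> \<in> space M. generation (\<lambda>k. X i k \<omega>) s = 1} \<in> events" for s
    by (rule generation_sets[OF X_measurable[OF u(2)]])
  then have int: "integrable M ?G"
    by (subst Bochner_Integration.integrable_cong[OF refl eq])
      (assumption, intro Bochner_Integration.integrable_sum integrable_indicator_event)
  have "expectation (num_resets u i T) \<le> expectation ?G"
    unfolding num_resets_def[abs_def] age_def
    by (intro integral_mono of_nat_mono resets_le_generations int
        num_resets_integrable[OF u, unfolded num_resets_def[abs_def] age_def])
  then show ?thesis
    using generations_expectation[OF u(2), of T] by linarith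
qed

lemma num_resets_le_attempts:
  assumes u: "u \<in> policies P M X cS cD R W" "i \<in> src"
  shows "expectation (num_resets u i T) \<le> pS P i * pD P i * (\<Sum>t=1..T. expectation (\<lambda>\<omega>. real (u i t \<omega>)))"
proof -
  have "expectation (num_resets u i T)
      \<le> expectation (\<lambda>\<omega>. real (card {t \<in> {1..T}. u i t \<omega> * cS i t \<omega> * cD i t \<omega> = 1}))"
    (is "_ \<le> ?E")
    unfolding num_resets_def[abs_def] age_def
    by (intro integral_mono of_nat_mono resets_le_deliveries expected_successes(2)[OF u]
        num_resets_integrable[OF u, unfolded num_resets_def[abs_def] age_def])
  also have "?E = pS P i * pD P i * (\<Sum>t=1..T. expectation (\<lambda>\<omega>. real (u i t \<omega>)))"
    by (rule expected_successes(1)[OF u])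
  finally show ?thesis .
qed

lemma policy_integrable:
  assumes u: "u \<in> policies P M X cS cD R W" "i \<in> src" "t \<ge> 1"
  shows "integrable M (\<lambda>\<omega>. real (u i t \<omega>))"
proof (rule integrable_const_bound[where B = 1])
  show "AE \<omega> in M. norm (real (u i t \<omega>)) \<le> 1"
    using policy_values[OF u] by (intro AE_I2) force
  show "(\<lambda>\<omega>. real (u i t \<omega>)) \<in> borel_measurable M"
    using policy_measurable[OF u] by measurable
qed

lemma policy_expectation_le_1:
  assumes u: "u \<in> policies P M X cS cD R W" "i \<in> src" "t \<ge> 1"
  shows "expectation (\<lambda>\<omega>. real (u i t \<omega>)) \<le> 1"
  using policy_values[OF u] by (intro integral_le_const policy_integrable[OF u] AE_I2) force

text \<open>The two bounds in the minimum \<open>v_max\<close> come from generations and from at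
  most one attempt per slot; the constant is the Wald overshoot.\<close>

lemma num_resets_le_v_max:
  assumes u: "u \<in> policies P M X cS cD R W" "i \<in> src"
  shows "expectation (num_resets u i T) \<le> v_max P i * real T + gen_rate P i * real (max_gap P i)"
proof -
  have "(\<Sum>t=1..T. expectation (\<lambda>\<omega>. real (u i t \<omega>))) \<le> (\<Sum>t=1..T. 1)"
    using policy_expectation_le_1[OF u] by (intro sum_mono) auto
  then have "pS P i * pD P i * (\<Sum>t=1..T. expectation (\<lambda>\<omega>. real (u i t \<omega>))) \<le> pS P i * pD P i * real T"
    using p_pos[OF u(2)] by (intro mult_left_mono) auto
  then have "expectation (num_resets u i T) \<le> pS P i * pD P i * real T"
    using num_resets_le_attempts[OF u, of T] by linarith
  moreover have "0 \<le> gen_rate P i * real (max_gap P i)"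
    using gen_rate_pos[OF u(2)] by simp
  ultimately show ?thesis
    using num_resets_le_generations[OF u, of T] by (simp add: v_max_def min_def distrib_left)
qed

text \<open>Division by the success probability turns expected resets into a lower bound on expected
  attempts, which the capacity limits slot by slot.\<close>

lemma num_resets_capacity:
  assumes u: "u \<in> policies P M X cS cD R W"
  shows "(\<Sum>i\<in>src. expectation (num_resets u i T) / (pS P i * pD P i)) \<le> real T * real (capacity P)"
proof -
  have "(\<Sum>i\<in>src. expectation (num_resets u i T) / (pS P i * pD P i))
      \<le> (\<Sum>i\<in>src. \<Sum>t=1..T. expectation (\<lambda>\<omega>. real (u i t \<omega>)))"
    using num_resets_le_attempts[OF u] p_pos by (intro sum_mono) (simp add: pos_divide_le_eq mult.commute)
  also have "\<dots> = (\<Sum>t=1..T. \<Sum>i\<in>src. expectation (\<lambda>\<omega>. real (u i t \<omega>)))"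
    by (rule sum.swap)
  also have "\<dots> \<le> (\<Sum>t=1..T. real (capacity P))"
  proof (rule sum_mono)
    fix t assume t: "t \<in> {1..T}"
    have int: "integrable M (\<lambda>\<omega>. real (u i t \<omega>))" if "i \<in> src" for i
      using policy_integrable[OF u that] t by simp
    have "(\<Sum>i\<in>src. expectation (\<lambda>\<omega>. real (u i t \<omega>))) = expectation (\<lambda>\<omega>. \<Sum>i\<in>src. real (u i t \<omega>))"
      by (rule Bochner_Integration.integral_sum[symmetric]) (rule int)
    also have "\<dots> \<le> real (capacity P)"
    proof (rule integral_le_const)
      show "integrable M (\<lambda>\<omega>. \<Sum>i\<in>src. real (u i t \<omega>))"
        by (intro Bochner_Integration.integrable_sum int)
      show "AE \<omega> in M. (\<Sum>i\<in>src. real (u i t \<omega>)) \<le> real (capacity P)"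
        using policy_capacity[OF u] t by (intro AE_I2) (simp flip: of_nat_sum)
    qed
    finally show "(\<Sum>i\<in>src. expectation (\<lambda>\<omega>. real (u i t \<omega>))) \<le> real (capacity P)" .
  qed
  finally show ?thesis
    by simp
qed

section \<open>Assembly of the lower bound\<close>

lemma expected_age_bound:
  fixes c :: real
  assumes u: "u \<in> policies P M X cS cD R W" "i \<in> src" and "T \<ge> 1"
  shows "(\<Sum>t=1..T. expectation (\<lambda>\<omega>. real (age P X cS cD u i t \<omega>)))
    \<ge> real T * (real (delay P i) + 1/2 + c) - c\<^sup>2 / 2 * (expectation (num_resets u i T) + 1)
      - c * real (delay P i) - (real (delay P i))\<^sup>2 / 2"
proof -
  let ?f = "\<lambda>\<omega>. real T * (real (delay P i) + 1/2 + c) - c\<^sup>2 / 2 * (num_resets u i T \<omega> + 1)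
      - c * real (delay P i) - (real (delay P i))\<^sup>2 / 2"
  note int = num_resets_integrable[OF u, of T]
  have "expectation ?f \<le> expectation (\<lambda>\<omega>. \<Sum>t=1..T. real (age P X cS cD u i t \<omega>))"
  proof (rule integral_mono)
    show "integrable M ?f" "integrable M (\<lambda>\<omega>. \<Sum>t=1..T. real (age P X cS cD u i t \<omega>))"
      by (simp_all add: int age_integrable[OF u])
    show "?f \<omega> \<le> (\<Sum>t=1..T. real (age P X cS cD u i t \<omega>))" for \<omega>
      unfolding num_resets_def age_def by (rule aoi_sum_bound[OF \<open>T \<ge> 1\<close>])
  qed
  moreover have "expectation ?f = real T * (real (delay P i) + 1/2 + c)
      - c\<^sup>2 / 2 * (expectation (num_resets u i T) + 1) - c * real (delay P i) - (real (delay P i))\<^sup>2 / 2"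
    by (simp add: int prob_space)
  ultimately show ?thesis
    by (simp add: age_integrable[OF u] Bochner_Integration.integral_sum)
qed

text \<open>All losses are bounded independently of the horizon, so averaging leaves an error of
  order \<open>1 / T\<close>.\<close>

lemma avg_age_bound:
  assumes mult: "constrained P \<longrightarrow> is_multiplier P \<gamma>" and u: "u \<in> policies P M X cS cD R W"
  shows "\<exists>C. \<forall>T\<ge>1. L_B P \<gamma> - C / real T \<le> avg_age P M X cS cD u T"
proof -
  define q where "q = q_LB P \<gamma>"
  define B where "B i = gen_rate P i * real (max_gap P i)" for i
  \<comment> \<open>\<open>B i\<close> is the Wald overshoot, the \<open>1\<close> pays for the
    unfinished interval, and the terms with \<open>delay\<close> pay for the phase before the first
    reset.\<close>
  define C where "C = (\<Sum>i\<in>src. wt P i * (1 / (q i)\<^sup>2 / 2 * (B i + 1)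
      + 1 / q i * real (delay P i) + (real (delay P i))\<^sup>2 / 2))"
  have N: "real (num_src P) > 0"
    using num_src_pos by simp
  have "L_B P \<gamma> - C / real (num_src P) / real T \<le> avg_age P M X cS cD u T" if T: "T \<ge> 1" for T
  proof -
    define g where "g i = expectation (num_resets u i T)" for i
    define a where "a i = (\<Sum>t=1..T. expectation (\<lambda>\<omega>. real (age P X cS cD u i t \<omega>)))" for i
    have resets: "(\<Sum>i\<in>src. wt P i / (q i)\<^sup>2 * g i)
        \<le> real T * (\<Sum>i\<in>src. wt P i / q i) + (\<Sum>i\<in>src. wt P i / (q i)\<^sup>2 * B i)"
      unfolding q_def
    proof (rule weighted_rate_bound[OF mult])
      show "g i \<le> v_max P i * real T + B i" if "i \<in> src" for i
        unfolding g_def B_def by (rule num_resets_le_v_max[OF u that])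
      show "B i \<ge> 0" if "i \<in> src" for i
        using gen_rate_pos[OF that] by (simp add: B_def)
      show "(\<Sum>i\<in>src. g i / (pS P i * pD P i)) \<le> real T * real (capacity P)"
        unfolding g_def by (rule num_resets_capacity[OF u])
    qed
    \<comment> \<open>The bound for a single source with \<open>c = 1 / q i\<close>, weighted and
      summed; the coefficient of \<open>g i\<close> becomes the one in
      \<open>weighted_rate_bound\<close>.\<close>
    have "real T * (\<Sum>i\<in>src. wt P i * (real (delay P i) + 1/2 + 1 / q i))
        - (\<Sum>i\<in>src. wt P i / (q i)\<^sup>2 * g i) / 2
        - (\<Sum>i\<in>src. wt P i * (1 / (q i)\<^sup>2 / 2 + 1 / q i * real (delay P i) + (real (delay P i))\<^sup>2 / 2))
      = (\<Sum>i\<in>src. wt P i * (real T * (real (delay P i) + 1/2 + 1 / q i)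
          - (1 / q i)\<^sup>2 / 2 * (g i + 1) - 1 / q i * real (delay P i) - (real (delay P i))\<^sup>2 / 2))"
      unfolding sum_distrib_left sum_divide_distrib sum_subtractf[symmetric]
      by (intro sum.cong) (simp_all add: power_one_over algebra_simps add_divide_distrib)
    also have "\<dots> \<le> (\<Sum>i\<in>src. wt P i * a i)"
    proof (intro sum_mono mult_left_mono)
      fix i assume i: "i \<in> src"
      show "real T * (real (delay P i) + 1/2 + 1 / q i) - (1 / q i)\<^sup>2 / 2 * (g i + 1)
          - 1 / q i * real (delay P i) - (real (delay P i))\<^sup>2 / 2 \<le> a i"
        unfolding a_def g_def by (rule expected_age_bound[OF u i T])
      show "0 \<le> wt P i"
        using wt_pos[OF i] by simp
    qed
    finally have *: "real T * (\<Sum>i\<in>src. wt P i * (real (delay P i) + 1/2 + 1 / q i))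
        - (\<Sum>i\<in>src. wt P i / (q i)\<^sup>2 * g i) / 2
        - (\<Sum>i\<in>src. wt P i * (1 / (q i)\<^sup>2 / 2 + 1 / q i * real (delay P i) + (real (delay P i))\<^sup>2 / 2))
      \<le> (\<Sum>i\<in>src. wt P i * a i)" .
    have "real T * (\<Sum>i\<in>src. wt P i * (real (delay P i) + 1/2 + 1 / q i))
        - (real T * (\<Sum>i\<in>src. wt P i / q i) + (\<Sum>i\<in>src. wt P i / (q i)\<^sup>2 * B i)) / 2
        - (\<Sum>i\<in>src. wt P i * (1 / (q i)\<^sup>2 / 2 + 1 / q i * real (delay P i) + (real (delay P i))\<^sup>2 / 2))
      \<le> (\<Sum>i\<in>src. wt P i * a i)"
      by (rule order_trans[OF _ *]) (intro diff_mono order_refl divide_right_mono resets, simp)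
    \<comment> \<open>The resets cost half of \<open>wt P i / q i\<close>, and the other half is the
      rate term of \<open>L_B\<close>.\<close>
    also have "real T * (\<Sum>i\<in>src. wt P i * (real (delay P i) + 1/2 + 1 / q i))
        - (real T * (\<Sum>i\<in>src. wt P i / q i) + (\<Sum>i\<in>src. wt P i / (q i)\<^sup>2 * B i)) / 2
        - (\<Sum>i\<in>src. wt P i * (1 / (q i)\<^sup>2 / 2 + 1 / q i * real (delay P i) + (real (delay P i))\<^sup>2 / 2))
      = real T * (\<Sum>i\<in>src. wt P i * (1 / q i + 2 * real (delay P i) + 1)) / 2 - C"
      unfolding C_def sum_distrib_left sum_divide_distrib sum_subtractf[symmetric] sum.distrib[symmetric]
      by (intro sum.cong) (simp_all add: algebra_simps add_divide_distrib)
    also have "real T * (\<Sum>i\<in>src. wt P i * (1 / q i + 2 * real (delay P i) + 1)) / 2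
        = real T * real (num_src P) * L_B P \<gamma>"
      using N by (simp add: L_B_def q_def)
    finally have "real T * real (num_src P) * L_B P \<gamma> - C \<le> (\<Sum>i\<in>src. wt P i * a i)" .
    moreover have "avg_age P M X cS cD u T = (\<Sum>i\<in>src. wt P i * a i) / (real T * real (num_src P))"
      unfolding avg_age_def a_def sum_distrib_left
      by (subst sum.swap) (simp add: sum_divide_distrib)
    ultimately have "(real T * real (num_src P) * L_B P \<gamma> - C) / (real T * real (num_src P))
        \<le> avg_age P M X cS cD u T"
      by (simp add: divide_right_mono)
    then show ?thesis
      using N T by (simp add: diff_divide_distrib mult.commute)
  qed
  then show ?thesis
    by blast
qed

text \<open>The error vanishes in the limit, and monotonicity of the limit inferior covers policies
  whose average age does not converge.\<close>

lemma ewsaoi_bound: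
  assumes "constrained P \<longrightarrow> is_multiplier P \<gamma>" "u \<in> policies P M X cS cD R W"
  shows "ereal (L_B P \<gamma>) \<le> ewsaoi P M X cS cD u"
proof -
  obtain C where C: "\<forall>T\<ge>1. L_B P \<gamma> - C / real T \<le> avg_age P M X cS cD u T"
    using avg_age_bound[OF assms] by blast
  have "(\<lambda>T. L_B P \<gamma> - C / real T) \<longlonglongrightarrow> L_B P \<gamma> - 0"
    by (intro tendsto_intros lim_const_over_n)
  then have "(\<lambda>T. ereal (L_B P \<gamma> - C / real T)) \<longlonglongrightarrow> ereal (L_B P \<gamma>)"
    by simp
  then have "ereal (L_B P \<gamma>) = liminf (\<lambda>T. ereal (L_B P \<gamma> - C / real T))"
    by (intro lim_imp_Liminf[symmetric]) auto
  also have "\<dots> \<le> ewsaoi P M X cS cD u"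
    unfolding ewsaoi_def using C
    by (intro Liminf_mono eventually_sequentiallyI[of 1]) auto
  finally show ?thesis .
qed

end

theorem theorem2:
  fixes M :: "'a measure" and P :: network
    and X cS cD :: "nat \<Rightarrow> nat \<Rightarrow> 'a \<Rightarrow> nat"
    and R :: "'r measure" and W :: "'a \<Rightarrow> 'r"
  assumes "aoi_network M P X cS cD R W"
  shows "(constrained P \<longrightarrow> (\<exists>\<gamma>. is_multiplier P \<gamma>)) \<and>
    (\<forall>\<gamma> \<gamma>'. is_multiplier P \<gamma> \<and> is_multiplier P \<gamma>' \<longrightarrow>
       (\<forall>i\<in>{1..num_src P}. q_of P \<gamma> i = q_of P \<gamma>' i)) \<and>
    (\<forall>\<gamma>. (constrained P \<longrightarrow> is_multiplier P \<gamma>) \<longrightarrow>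
       (\<forall>u\<in>policies P M X cS cD R W. ereal (L_B P \<gamma>) \<le> ewsaoi P M X cS cD u))"
proof -
  interpret aoi_network M P X cS cD R W
    by (fact assms)
  show ?thesis
    using multiplier_exists q_of_multiplier_unique ewsaoi_bound by blast
qed

end
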